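(* Let $n\ge3$ and let $m_1<\cdots<m_n$ be positive integers with $m_i=h\,m_1+(i-1)d$ for all $i\in\{2,\ldots,n\}$, where $h,d\in\mathbb{Z}^+$, $\gcd\{m_1,d\}=1$, $h>1$ and $h$ divides $d$. Let $\delta$, and $\beta_j,\sigma_j,\lambda_j$ for $1\le j\le\delta/h$, be the integers associated with this sequence as defined in the context. Let $\mathcal{G}_1\subset K[x_2,\ldots,x_{n+1}]$ be a minimal Gröbner basis of $I(\mathcal{C}')$ with respect to the degree reverse lexicographic order, where $\mathcal{C}'$ is the projective monomial curve associated to the arithmetic sequence $m_2<\cdots<m_n$. Then $$\mathcal{G}:=\mathcal{G}_1\cup\{x_1^hx_i-x_2x_{i-1}x_{n+1}^{h-1}\mid 3\le i\le n\}\cup\{x_1^{jh}x_2^{\beta_j}-x_{\sigma_j}x_n^{\lambda_j}x_{n+1}^{j(h-1)+(d/h)}\mid 1\le j\le\delta/h\}$$ is a minimal Gröbner basis of $I(\mathcal{C})$ with respect to the degree reverse lexicographic order. Moreover, $\mathcal{G}$ is a minimal set of generators of $I(\mathcal{C})$.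
   Context: $K$ is an infinite field, $R=K[x_1,\ldots,x_{n+1}]$, $0\in\mathbb{N}$. The projective monomial curve $\mathcal{C}\subset\mathbb{P}^n_K$ associated to $m_1<\cdots<m_n$ has vanishing ideal $I(\mathcal{C})\subset R$ equal to the kernel of the $K$-algebra homomorphism $R\to K[u,v]$, $x_i\mapsto u^{m_i}v^{m_n-m_i}$ ($1\le i\le n$), $x_{n+1}\mapsto v^{m_n}$. Likewise $I(\mathcal{C}')\subset K[x_2,\ldots,x_{n+1}]$ is the kernel of the restriction of this homomorphism to $K[x_2,\ldots,x_{n+1}]$. The degree reverse lexicographic order is taken with $x_1>x_2>\cdots>x_{n+1}$ (respectively $x_2>\cdots>x_{n+1}$). A Gröbner basis is minimal if its elements have leading coefficient $1$ and no leading monomial of one of its elements divides the leading monomial of another. Integers associated with the sequence: let $p\in\mathbb{N}$ and $s\in\{1,\ldots,n-1\}$ be such that $m_1=p(n-1)+s$, and set $\delta:=ph+d+h$ (so $h$ divides $\delta$). For $j\in\{0,\ldots,\delta/h-1\}$ set $\beta_j:=\min\{b\in\mathbb{Z}^+\mid (jh)m_1+b\,m_2\in\sum_{i=3}^n\mathbb{N}m_i\}$; there exist unique $\sigma_j\in\{3,\ldots,n\}$ and $\lambda_j\in\mathbb{N}$ with $jhm_1+\beta_jm_2=m_{\sigma_j}+\lambda_jm_n$, and these define $\sigma_j,\lambda_j$. For $j=\delta/h$ set $\beta_{\delta/h}:=0$, $\sigma_{\delta/h}:=s+1$, $\lambda_{\delta/h}:=p$. *)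

theory Defs
  imports Complex_Main "HOL-Library.Poly_Mapping"
begin

text \<open>
  Monomials in variables indexed by \<open>'v\<close> are finitely supported exponent vectors, and polynomials
  are finitely supported coefficient functions on monomials.
  The ring \<open>K[x\<^sub>i | i \<in> A]\<close> is the subring \<open>polys_in A\<close> of
  \<open>(nat, 'k) mpoly\<close>, and the variable \<open>x\<^sub>i\<close> has index \<open>i\<close> (counting from 1).
\<close>

type_synonym 'v monom = "'v \<Rightarrow>\<^sub>0 nat"
type_synonym ('v, 'k) mpoly = "('v \<Rightarrow>\<^sub>0 nat) \<Rightarrow>\<^sub>0 'k"

definition monomial :: "'v monom \<Rightarrow> ('v, 'k::field) mpoly" where
  "monomial t = Poly_Mapping.single t 1"

definition X :: "'v \<Rightarrow> ('v, 'k::field) mpoly" where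
  "X i = monomial (Poly_Mapping.single i 1)"

definition Const :: "'k::field \<Rightarrow> ('v, 'k) mpoly" where
  "Const c = Poly_Mapping.single 0 c"

definition polys_in :: "'v set \<Rightarrow> ('v, 'k::field) mpoly set" where
  "polys_in A = {f. \<forall>t \<in> Poly_Mapping.keys f. Poly_Mapping.keys t \<subseteq> A}"

text \<open>The \<open>K\<close>-algebra homomorphism sending each variable \<open>x\<^sub>i\<close> to \<open>g i\<close>.\<close>

definition poly_subst :: "('v \<Rightarrow> ('w, 'k) mpoly) \<Rightarrow> ('v, 'k::field) mpoly \<Rightarrow> ('w, 'k) mpoly" where
  "poly_subst g f =
    (\<Sum>t \<in> Poly_Mapping.keys f. Const (Poly_Mapping.lookup f t) *
      (\<Prod>i \<in> Poly_Mapping.keys t. g i ^ Poly_Mapping.lookup t i))"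

text \<open>The ideal of \<open>K[x\<^sub>i | i \<in> A]\<close> generated by \<open>G\<close>; the coefficients range over that ring only.\<close>

definition ideal_gen :: "'v set \<Rightarrow> ('v, 'k::field) mpoly set \<Rightarrow> ('v, 'k) mpoly set" where
  "ideal_gen A G =
    {\<Sum>g\<in>F. c g * g | F c. finite F \<and> F \<subseteq> G \<and> (\<forall>g\<in>F. c g \<in> polys_in A)}"

definition minimal_generating_set ::
    "'v set \<Rightarrow> ('v, 'k::field) mpoly set \<Rightarrow> ('v, 'k) mpoly set \<Rightarrow> bool" where
  "minimal_generating_set A I G \<longleftrightarrow>
    ideal_gen A G = I \<and> (\<forall>H. H \<subset> G \<longrightarrow> ideal_gen A H \<noteq> I)"


definition monom_degree :: "'v monom \<Rightarrow> nat" where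
  "monom_degree t = (\<Sum>i \<in> Poly_Mapping.keys t. Poly_Mapping.lookup t i)"

text \<open>
  Degree reverse lexicographic order with \<open>x\<^sub>1 > x\<^sub>2 > \<dots>\<close>: for equal degrees, the monomial
  with the larger exponent at the largest index where the two differ is the smaller one.
  The order on the monomials of a subring \<open>polys_in A\<close> is the restriction of this one.
\<close>

definition drl_less :: "nat monom \<Rightarrow> nat monom \<Rightarrow> bool" where
  "drl_less s t \<longleftrightarrow>
    monom_degree s < monom_degree t \<or>
    (monom_degree s = monom_degree t \<and>
      (\<exists>i. Poly_Mapping.lookup s i > Poly_Mapping.lookup t i \<and>
        (\<forall>j>i. Poly_Mapping.lookup s j = Poly_Mapping.lookup t j)))"

text \<open>Leading monomial and leading coefficient; meaningful for \<open>f \<noteq> 0\<close>.\<close>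

definition lead_monom :: "(nat, 'k::field) mpoly \<Rightarrow> nat monom" where
  "lead_monom f =
    (THE t. t \<in> Poly_Mapping.keys f \<and> (\<forall>s \<in> Poly_Mapping.keys f. s \<noteq> t \<longrightarrow> drl_less s t))"

definition leading_coefficient :: "(nat, 'k::field) mpoly \<Rightarrow> 'k" where
  "leading_coefficient f = Poly_Mapping.lookup f (lead_monom f)"

definition monom_dvd :: "'v monom \<Rightarrow> 'v monom \<Rightarrow> bool" where
  "monom_dvd s t \<longleftrightarrow> (\<exists>u. t = s + u)"

definition initial_ideal :: "nat set \<Rightarrow> (nat, 'k::field) mpoly set \<Rightarrow> (nat, 'k) mpoly set" where
  "initial_ideal A I = ideal_gen A ((\<lambda>f. monomial (lead_monom f)) ` (I - {0}))"

definition groebner_basis ::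
    "nat set \<Rightarrow> (nat, 'k::field) mpoly set \<Rightarrow> (nat, 'k) mpoly set \<Rightarrow> bool" where
  "groebner_basis A I G \<longleftrightarrow>
    finite G \<and> G \<subseteq> I \<and>
    ideal_gen A ((\<lambda>g. monomial (lead_monom g)) ` (G - {0})) = initial_ideal A I"

definition minimal_groebner_basis ::
    "nat set \<Rightarrow> (nat, 'k::field) mpoly set \<Rightarrow> (nat, 'k) mpoly set \<Rightarrow> bool" where
  "minimal_groebner_basis A I G \<longleftrightarrow>
    groebner_basis A I G \<and>
    (\<forall>g\<in>G. leading_coefficient g = 1) \<and>
    (\<forall>f\<in>G. \<forall>g\<in>G. f \<noteq> g \<longrightarrow> \<not> monom_dvd (lead_monom f) (lead_monom g))"


datatype uv = U_var | V_var

definition curve_param :: "nat \<Rightarrow> (nat \<Rightarrow> nat) \<Rightarrow> nat \<Rightarrow> (uv, 'k::field) mpoly" where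
  "curve_param n m i =
    (if i = n + 1 then X V_var ^ m n else X U_var ^ m i * X V_var ^ (m n - m i))"

text \<open>
  The kernel of the parametrization restricted to the variables \<open>x\<^sub>k, \<dots>, x\<^bsub>n+1\<^esub>\<close>: for
  \<open>k = 1\<close> it is \<open>I(C)\<close>, and for \<open>k = 2\<close> it is \<open>I(C')\<close>, where \<open>C'\<close> is associated to
  \<open>m\<^sub>2 < \<dots> < m\<^sub>n\<close>.
\<close>

definition curve_ideal :: "nat \<Rightarrow> nat \<Rightarrow> (nat \<Rightarrow> nat) \<Rightarrow> (nat, 'k::field) mpoly set" where
  "curve_ideal k n m = {f \<in> polys_in {k..n+1}. poly_subst (curve_param n m) f = 0}"


definition delta :: "nat \<Rightarrow> nat \<Rightarrow> nat \<Rightarrow> nat" where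
  "delta h d p = p * h + d + h"

definition tail_semigroup :: "nat \<Rightarrow> (nat \<Rightarrow> nat) \<Rightarrow> nat set" where
  "tail_semigroup n m = {\<Sum>i=3..n. c i * m i | c. True}"

definition beta :: "nat \<Rightarrow> (nat \<Rightarrow> nat) \<Rightarrow> nat \<Rightarrow> nat \<Rightarrow> nat \<Rightarrow> nat \<Rightarrow> nat" where
  "beta n m h d p j =
    (if j = delta h d p div h then 0
     else (LEAST b. 0 < b \<and> (j * h) * m 1 + b * m 2 \<in> tail_semigroup n m))"

definition sigma_lambda ::
    "nat \<Rightarrow> (nat \<Rightarrow> nat) \<Rightarrow> nat \<Rightarrow> nat \<Rightarrow> nat \<Rightarrow> nat \<Rightarrow> nat \<Rightarrow> nat \<times> nat" where
  "sigma_lambda n m h d p s j =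
    (if j = delta h d p div h then (s + 1, p)
     else (THE (sig, lam). sig \<in> {3..n} \<and>
             (j * h) * m 1 + beta n m h d p j * m 2 = m sig + lam * m n))"

definition sigma where "sigma n m h d p s j = fst (sigma_lambda n m h d p s j)"
definition lambda where "lambda n m h d p s j = snd (sigma_lambda n m h d p s j)"

end

(*
  The K-algebra homomorphism maps monomials to monomials, so a polynomial lies in I(C) iff its
  coefficients sum to zero over each fiber (a set of monomials with equal image).  Hence the initial
  ideal is spanned by the monomials that are not minimal in their fiber.  If two monomials of a fiber
  have different exponents of x_1, arithmetic modulo h and m_1 shows that the one with the larger
  exponent is divisible by x_1^h x_i or x_1^(jh) x_2^beta_j; if the exponents agree, x_1 cancels and
  I(C') takes over.

  For minimal generation, join two monomials of a fiber when they share a variable.  A polynomial in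
  mI, where m is generated by the variables, has coefficient sum zero on each connected component.
  Each minimal generator of the initial ideal is the least monomial of its component, so G is linearly
  independent modulo mI, even when the elements of G1 are not homogeneous.
*)

theory Submission
  imports Defs
begin

section \<open>Monomials\<close>

text \<open>Since h divides d, m_i = h(m_1 + (i-1)e) for i >= 2, with \<open>e = d div h\<close>.
  Degree and weight of a monomial see only its exponents of x_1 and x_{n+1}, the number R of its
  factors among x_2, ..., x_n and their total step count T (\<open>tail_count\<close>,
  \<open>tail_weight\<close>). Coprimality makes two members of a fiber differ by integers l, k: the
  exponent of x_1 by lh, T by k m_1, R by -l - ke. A pair (R, T) is attained by a monomial in x_2,
  ..., x_n exactly when R <= T <= R(n-1). Divisibility questions thus become linear inequalities in
  k and l, and beta_j is the ceiling at which k = 1 becomes possible. The obstacle to minimal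
  generation is that \<open>G1\<close> is arbitrary, so only its leading monomials can be
  controlled. Membership in the initial ideal of I(C') is therefore phrased without
  \<open>G1\<close> (\<open>reducible2\<close>); its minimal members of degree at least 3 turn out
  to be x_2^alpha x_i, whose component can be written down. The coefficient sum over a component is
  the separating functional: it vanishes on all monomials below the least one, so these functionals
  are triangular against the basis.\<close>

abbreviation lookup where "lookup \<equiv> Poly_Mapping.lookup"
abbreviation keys where "keys \<equiv> Poly_Mapping.keys"
abbreviation single where "single \<equiv> Poly_Mapping.single"

lemma keys_add_nat: "keys (s + t) = keys s \<union> keys (t :: 'v monom)"
  by (auto simp: in_keys_iff lookup_add)

lemma keys_single_subset: "keys (single i k) \<subseteq> {i}"
  by (simp add: in_keys_iff lookup_single when_def subset_iff)

definition wdeg :: "('v \<Rightarrow> nat) \<Rightarrow> 'v monom \<Rightarrow> nat" where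
  "wdeg w t = (\<Sum>i\<in>keys t. lookup t i * w i)"

lemma wdeg_superset: "finite A \<Longrightarrow> keys t \<subseteq> A \<Longrightarrow> wdeg w t = (\<Sum>i\<in>A. lookup t i * w i)"
  unfolding wdeg_def by (rule sum.mono_neutral_left) (auto simp: in_keys_iff)

lemma wdeg_add: "wdeg w (s + t) = wdeg w s + wdeg w t"
proof -
  let ?A = "keys s \<union> keys t"
  have "wdeg w u = (\<Sum>i\<in>?A. lookup u i * w i)" if "u \<in> {s, t, s + t}" for u
    using that by (intro wdeg_superset) (auto simp: keys_add_nat)
  then show ?thesis
    by (simp add: lookup_add sum.distrib algebra_simps)
qed

lemma wdeg_zero [simp]: "wdeg w 0 = 0"
  by (simp add: wdeg_def)

lemma wdeg_single [simp]: "wdeg w (single i k) = k * w i"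
  by (simp add: wdeg_def)

lemma monom_degree_conv_wdeg: "monom_degree = wdeg (\<lambda>_. 1)"
  by (simp add: monom_degree_def wdeg_def fun_eq_iff)

lemma monom_degree_add: "monom_degree (s + t) = monom_degree s + monom_degree t"
  by (simp add: monom_degree_conv_wdeg wdeg_add)

lemma monom_degree_single [simp]: "monom_degree (single i k) = k"
  by (simp add: monom_degree_conv_wdeg)

lemma lookup_le_monom_degree: "lookup t i \<le> monom_degree t"
  by (cases "i \<in> keys t") (auto simp: monom_degree_def in_keys_iff intro: member_le_sum)

lemma monom_degree_eq_0: "monom_degree t = 0 \<Longrightarrow> t = 0"
  using lookup_le_monom_degree[of t] by (intro poly_mapping_eqI) simp

lemma split_variable:
  fixes t :: "'v monom"
  assumes "k \<le> lookup t i"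
  obtains u where "t = single i k + u"
proof
  show "t = single i k + (t - single i k)"
    using assms by (intro poly_mapping_eqI) (auto simp: lookup_add lookup_minus lookup_single when_def)
qed

lemma monom_degree_eq_1:
  assumes "monom_degree t = 1"
  obtains i where "t = single i 1"
proof -
  from assms have "keys t \<noteq> {}"
    by (auto simp: monom_degree_def)
  then obtain i where "i \<in> keys t"
    by blast
  then have "lookup t i \<ge> 1"
    by (simp add: in_keys_iff)
  then obtain u where u: "t = single i 1 + u"
    by (rule split_variable)
  with assms have "u = 0"
    by (intro monom_degree_eq_0) (simp add: monom_degree_add)
  with u that show ?thesis by simp
qed

lemma monom_dvd_refl: "monom_dvd t t"
  unfolding monom_dvd_def by (rule exI[of _ 0]) simp

lemma monom_dvd_trans: "monom_dvd r s \<Longrightarrow> monom_dvd s t \<Longrightarrow> monom_dvd r t"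
  unfolding monom_dvd_def by (metis add.assoc)

lemma monom_dvd_iff: "monom_dvd s t \<longleftrightarrow> (\<forall>i. lookup s i \<le> lookup t i)"
proof
  assume "\<forall>i. lookup s i \<le> lookup t i"
  then have "t = s + (t - s)"
    by (intro poly_mapping_eqI) (simp add: lookup_add lookup_minus)
  then show "monom_dvd s t" unfolding monom_dvd_def by blast
qed (auto simp: monom_dvd_def lookup_add)

lemma monom_dvd_antisym: "monom_dvd s t \<Longrightarrow> monom_dvd t s \<Longrightarrow> s = t"
  by (auto simp: monom_dvd_iff intro!: poly_mapping_eqI le_antisym)

lemma finite_monoms_bounded:
  assumes "finite A"
  shows "finite {t :: 'v monom. keys t \<subseteq> A \<and> monom_degree t \<le> D}"
proof -
  have "lookup ` {t :: 'v monom. keys t \<subseteq> A \<and> monom_degree t \<le> D}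
      \<subseteq> {f. \<forall>i. (i \<in> A \<longrightarrow> f i \<in> {..D}) \<and> (i \<notin> A \<longrightarrow> f i = 0)}"
    by (auto simp: not_in_keys_iff_lookup_eq_zero subset_iff
        intro: order_trans[OF lookup_le_monom_degree])
  moreover have "finite {f. \<forall>i. (i \<in> A \<longrightarrow> f i \<in> {..D}) \<and> (i \<notin> A \<longrightarrow> f i = 0)}"
    using assms by (intro finite_set_of_finite_funs) auto
  ultimately have "finite (lookup ` {t :: 'v monom. keys t \<subseteq> A \<and> monom_degree t \<le> D})"
    by (rule finite_subset)
  then show ?thesis
    by (rule finite_imageD) (auto intro: inj_onI poly_mapping_eqI)
qed

section \<open>The degree reverse lexicographic order\<close>

lemma drl_irrefl: "\<not> drl_less t t"
  by (simp add: drl_less_def)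

lemma drl_trans:
  assumes "drl_less r s" "drl_less s t"
  shows "drl_less r t"
proof (cases "monom_degree r = monom_degree s \<and> monom_degree s = monom_degree t")
  case True
  with assms obtain i j where i: "lookup r i > lookup s i" "\<forall>k>i. lookup r k = lookup s k"
    and j: "lookup s j > lookup t j" "\<forall>k>j. lookup s k = lookup t k"
    unfolding drl_less_def by auto
  \<comment> \<open>The higher of the two deciding indices decides between \<open>r\<close> and
    \<open>t\<close>.\<close>
  have "lookup r (max i j) > lookup t (max i j)"
    using i j by (cases i j rule: linorder_cases) (auto simp: max_def)
  moreover have "\<forall>k>max i j. lookup r k = lookup t k"
    using i j by auto
  ultimately show ?thesis
    using True unfolding drl_less_def by (intro disjI2 conjI exI[of _ "max i j"]) simp_all
next
  case False
  with assms show ?thesis unfolding drl_less_def by auto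
qed

lemma drl_total:
  assumes "s \<noteq> t"
  shows "drl_less s t \<or> drl_less t s"
proof (cases "monom_degree s = monom_degree t")
  case True
  let ?D = "{i. lookup s i \<noteq> lookup t i}"
  have "?D \<subseteq> keys s \<union> keys t"
    by (auto simp: in_keys_iff)
  then have fin: "finite ?D"
    by (rule finite_subset) simp
  have "?D \<noteq> {}"
    using assms by (auto intro: poly_mapping_eqI)
  with fin have "Max ?D \<in> ?D"
    by (rule Max_in)
  moreover have "\<forall>j>Max ?D. lookup s j = lookup t j"
    using fin Max_ge by fastforce
  ultimately show ?thesis
    using True unfolding drl_less_def by (metis (mono_tags, lifting) mem_Collect_eq nat_neq_iff)
qed (auto simp: drl_less_def)

lemma drl_asym: "drl_less s t \<Longrightarrow> \<not> drl_less t s"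
  using drl_trans drl_irrefl by blast

lemma drl_add_iff: "drl_less (u + s) (u + t) \<longleftrightarrow> drl_less s t"
  unfolding drl_less_def by (simp add: monom_degree_add lookup_add)

lemma drl_degree: "drl_less s t \<Longrightarrow> monom_degree s \<le> monom_degree t"
  by (auto simp: drl_less_def)

lemma drl_lessI_top:
  assumes "monom_degree s = monom_degree t" "lookup t k < lookup s k"
    and "\<And>j. j > k \<Longrightarrow> lookup s j = lookup t j"
  shows "drl_less s t"
  using assms unfolding drl_less_def by blast

lemma drl_top_le:
  assumes "drl_less s t" "monom_degree s = monom_degree t"
    and "\<And>j. j > k \<Longrightarrow> lookup s j = lookup t j"
  shows "lookup t k \<le> lookup s k"
proof (rule ccontr)
  assume "\<not> ?thesis"
  then have "drl_less t s"
    using assms by (intro drl_lessI_top[of _ _ k]) auto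
  with assms(1) show False using drl_asym by blast
qed

lemma drl_min_exists:
  assumes "finite S" "S \<noteq> {}"
  obtains t where "t \<in> S" "\<And>s. s \<in> S \<Longrightarrow> s \<noteq> t \<Longrightarrow> drl_less t s"
proof -
  have "\<exists>t\<in>S. \<forall>s\<in>S. s \<noteq> t \<longrightarrow> drl_less t s"
    using assms
  proof (induction rule: finite_ne_induct)
    case (insert x F)
    then obtain t where t: "t \<in> F" "\<forall>s\<in>F. s \<noteq> t \<longrightarrow> drl_less t s" by blast
    show ?case
    proof (cases "drl_less x t")
      case True
      then have "\<forall>s\<in>insert x F. s \<noteq> x \<longrightarrow> drl_less x s"
        using t drl_trans by (metis insert_iff)
      then show ?thesis by blast
    next
      case False
      then show ?thesis using t drl_total by (metis insert_iff)
    qed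
  qed auto
  with that show ?thesis by blast
qed

lemma drl_max_exists:
  assumes "finite S" "S \<noteq> {}"
  obtains t where "t \<in> S" "\<And>s. s \<in> S \<Longrightarrow> s \<noteq> t \<Longrightarrow> drl_less s t"
proof -
  have "\<exists>t\<in>S. \<forall>s\<in>S. s \<noteq> t \<longrightarrow> drl_less s t"
    using assms
  proof (induction rule: finite_ne_induct)
    case (insert x F)
    then obtain t where t: "t \<in> F" "\<forall>s\<in>F. s \<noteq> t \<longrightarrow> drl_less s t" by blast
    show ?case
    proof (cases "drl_less t x")
      case True
      then have "\<forall>s\<in>insert x F. s \<noteq> x \<longrightarrow> drl_less s x"
        using t drl_trans by (metis insert_iff)
      then show ?thesis by blast
    next
      case False
      then show ?thesis using t drl_total by (metis insert_iff)
    qed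
  qed auto
  with that show ?thesis by blast
qed

text \<open>The order compares degrees first, so over a finite set of variables each monomial has
  finitely many predecessors; their number is the induction measure.\<close>

lemma drl_induct:
  assumes "finite A" "keys t \<subseteq> A"
    and step: "\<And>t. keys t \<subseteq> A \<Longrightarrow> (\<And>s. keys s \<subseteq> A \<Longrightarrow> drl_less s t \<Longrightarrow> P s) \<Longrightarrow> P t"
  shows "P t"
  using assms(2)
proof (induction "card {s. keys s \<subseteq> A \<and> drl_less s t}" arbitrary: t rule: less_induct)
  case less
  have fin: "finite {s. keys s \<subseteq> A \<and> drl_less s t}"
    by (rule finite_subset[OF _ finite_monoms_bounded[OF assms(1), of "monom_degree t"]])
      (auto dest: drl_degree)
  show ?case
  proof (rule step[OF less.prems])
    fix s assume s: "keys s \<subseteq> A" "drl_less s t"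
    have "{r. keys r \<subseteq> A \<and> drl_less r s} \<subset> {r. keys r \<subseteq> A \<and> drl_less r t}"
      using s drl_trans drl_irrefl by blast
    then show "P s"
      using less.hyps[OF psubset_card_mono[OF fin]] s by blast
  qed
qed

section \<open>Leading monomials\<close>

lemma lead_monom_eqI:
  assumes "t \<in> keys f" "\<And>s. s \<in> keys f \<Longrightarrow> s \<noteq> t \<Longrightarrow> drl_less s t"
  shows "lead_monom f = t"
  unfolding lead_monom_def
proof (rule the_equality)
  fix u assume u: "u \<in> keys f \<and> (\<forall>s\<in>keys f. s \<noteq> u \<longrightarrow> drl_less s u)"
  show "u = t"
  proof (rule ccontr)
    assume "u \<noteq> t"
    then have "drl_less u t" "drl_less t u"
      using u assms by auto
    then show False using drl_asym by blast
  qed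
qed (use assms in auto)

lemma lead_monom:
  assumes "f \<noteq> 0"
  shows lead_monom_in_keys: "lead_monom f \<in> keys f"
    and lead_monom_greatest: "s \<in> keys f \<Longrightarrow> s \<noteq> lead_monom f \<Longrightarrow> drl_less s (lead_monom f)"
proof -
  have "keys f \<noteq> {}"
    using assms by (metis in_keys_iff lookup_zero poly_mapping_eqI empty_iff)
  then obtain t where t: "t \<in> keys f" "\<And>s. s \<in> keys f \<Longrightarrow> s \<noteq> t \<Longrightarrow> drl_less s t"
    using drl_max_exists[OF finite_keys] by blast
  then have "lead_monom f = t" by (rule lead_monom_eqI)
  with t show "lead_monom f \<in> keys f" "s \<in> keys f \<Longrightarrow> s \<noteq> lead_monom f \<Longrightarrow> drl_less s (lead_monom f)"
    by auto
qed

lemma lookup_above_lead_monom: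
  assumes "f \<noteq> 0" "drl_less (lead_monom f) t"
  shows "lookup f t = 0"
  using assms lead_monom_greatest[OF assms(1), of t] drl_asym drl_irrefl
  by (metis in_keys_iff)

lemma lookup_monomial: "lookup (monomial s) t = (if s = t then 1 else 0)"
  by (simp add: monomial_def lookup_single when_def)

lemma keys_monomial [simp]: "keys (monomial t :: ('v, 'k::field) mpoly) = {t}"
  by (simp add: monomial_def)

lemma keys_binomial:
  assumes "s \<noteq> t"
  shows "keys (monomial t - monomial s :: ('v, 'k::field) mpoly) = {s, t}"
  using assms by (auto simp: in_keys_iff lookup_minus lookup_monomial split: if_splits)

lemma lead_monom_binomial:
  assumes "drl_less s t"
  shows "lead_monom (monomial t - monomial s :: (nat, 'k::field) mpoly) = t"
    and "leading_coefficient (monomial t - monomial s :: (nat, 'k::field) mpoly) = 1"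
proof -
  have ne: "s \<noteq> t" using assms drl_irrefl by blast
  show *: "lead_monom (monomial t - monomial s :: (nat, 'k::field) mpoly) = t"
    using assms by (intro lead_monom_eqI) (auto simp: keys_binomial[OF ne])
  show "leading_coefficient (monomial t - monomial s :: (nat, 'k::field) mpoly) = 1"
    unfolding leading_coefficient_def * using ne by (simp add: lookup_minus lookup_monomial)
qed

lemma monomial_mult: "monomial s * monomial t = (monomial (s + t) :: ('v, 'k::field) mpoly)"
  by (simp add: monomial_def mult_single)

lemma monomial_zero: "monomial 0 = (1 :: ('v, 'k::field) mpoly)"
  by (simp add: monomial_def)

lemma X_power: "(X i :: ('v, 'k::field) mpoly) ^ k = monomial (single i k)"
  by (induction k) (simp_all add: X_def monomial_zero monomial_mult flip: single_add)

lemma leading_coefficient_zero: "leading_coefficient 0 = 0"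
  by (simp add: leading_coefficient_def)

section \<open>Linear functionals on polynomials\<close>

text \<open>With indicator functions for \<open>\<phi>\<close> this covers coefficient extraction,
  sums over a fiber and sums over a component alike.\<close>

definition linear_ext :: "('v monom \<Rightarrow> 'k) \<Rightarrow> ('v, 'k::field) mpoly \<Rightarrow> 'k" where
  "linear_ext \<phi> f = (\<Sum>t\<in>keys f. lookup f t * \<phi> t)"

lemma linear_ext_superset:
  "finite B \<Longrightarrow> keys f \<subseteq> B \<Longrightarrow> linear_ext \<phi> f = (\<Sum>t\<in>B. lookup f t * \<phi> t)"
  unfolding linear_ext_def by (rule sum.mono_neutral_left) (auto simp: in_keys_iff)

lemma linear_ext_zero [simp]: "linear_ext \<phi> 0 = 0"
  by (simp add: linear_ext_def)

lemma linear_ext_add: "linear_ext \<phi> (f + g) = linear_ext \<phi> f + linear_ext \<phi> g"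
proof -
  let ?B = "keys f \<union> keys g"
  have "linear_ext \<phi> f = (\<Sum>t\<in>?B. lookup f t * \<phi> t)"
    "linear_ext \<phi> g = (\<Sum>t\<in>?B. lookup g t * \<phi> t)"
    "linear_ext \<phi> (f + g) = (\<Sum>t\<in>?B. lookup (f + g) t * \<phi> t)"
    using Poly_Mapping.keys_add[of f g] by (auto intro!: linear_ext_superset)
  then show ?thesis
    by (simp add: lookup_add sum.distrib algebra_simps)
qed

lemma linear_ext_uminus: "linear_ext \<phi> (- f) = - linear_ext \<phi> f"
proof -
  have "keys (- f) = keys f" by (auto simp: in_keys_iff)
  then show ?thesis by (simp add: linear_ext_def sum_negf)
qed

lemma linear_ext_diff: "linear_ext \<phi> (f - g) = linear_ext \<phi> f - linear_ext \<phi> g"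
  using linear_ext_add[of \<phi> f "- g"] by (simp add: linear_ext_uminus)

lemma linear_ext_sum: "linear_ext \<phi> (\<Sum>x\<in>F. f x) = (\<Sum>x\<in>F. linear_ext \<phi> (f x))"
  by (induction F rule: infinite_finite_induct) (simp_all add: linear_ext_add)

lemma linear_ext_single [simp]: "linear_ext \<phi> (single t c) = c * \<phi> t"
  by (simp add: linear_ext_def)

lemma linear_ext_monomial [simp]: "linear_ext \<phi> (monomial t) = \<phi> t"
  by (simp add: monomial_def)

lemma poly_eq_sum_single: "f = (\<Sum>t\<in>keys f. single t (lookup f t))"
proof (rule poly_mapping_eqI)
  fix u
  have "lookup (\<Sum>t\<in>keys f. single t (lookup f t)) u = (\<Sum>t\<in>keys f. if t = u then lookup f t else 0)"
    by (simp add: lookup_sum lookup_single when_def)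
  also have "\<dots> = lookup f u"
    by (simp add: sum.delta in_keys_iff)
  finally show "lookup f u = lookup (\<Sum>t\<in>keys f. single t (lookup f t)) u" by simp
qed

lemma linear_ext_single_mult:
  "linear_ext \<phi> (single u c * f) = c * linear_ext (\<lambda>t. \<phi> (u + t)) f"
proof -
  have "single u c * f = (\<Sum>t\<in>keys f. single (u + t) (c * lookup f t))"
    by (subst poly_eq_sum_single[of f]) (simp add: sum_distrib_left mult_single)
  then show ?thesis
    by (simp add: linear_ext_sum sum_distrib_left linear_ext_def[of _ f] mult.assoc)
qed

lemma linear_ext_mult:
  "linear_ext \<phi> (g * f) = (\<Sum>u\<in>keys g. lookup g u * linear_ext (\<lambda>t. \<phi> (u + t)) f)"
proof -
  have "g * f = (\<Sum>u\<in>keys g. single u (lookup g u) * f)"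
    by (subst poly_eq_sum_single[of g]) (simp add: sum_distrib_right)
  then show ?thesis
    by (simp add: linear_ext_sum linear_ext_single_mult)
qed

lemma linear_ext_cong:
  "(\<And>t. t \<in> keys f \<Longrightarrow> \<phi> t = \<psi> t) \<Longrightarrow> linear_ext \<phi> f = linear_ext \<psi> f"
  by (simp add: linear_ext_def)

section \<open>Ideals\<close>

lemma polys_in_iff: "f \<in> polys_in A \<longleftrightarrow> keys f \<subseteq> {t. keys t \<subseteq> A}"
  by (auto simp: polys_in_def)

lemma polys_in_zero: "0 \<in> polys_in A"
  by (simp add: polys_in_def)

lemma polys_in_single: "keys t \<subseteq> A \<Longrightarrow> single t c \<in> polys_in A"
  using keys_single_subset[of t c] by (auto simp: polys_in_def)

lemma polys_in_monomial: "keys t \<subseteq> A \<Longrightarrow> monomial t \<in> polys_in A"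
  by (simp add: polys_in_def)

lemma polys_in_one: "1 \<in> polys_in A"
  unfolding monomial_zero[symmetric] by (rule polys_in_monomial) simp

lemma polys_in_add: "f \<in> polys_in A \<Longrightarrow> g \<in> polys_in A \<Longrightarrow> f + g \<in> polys_in A"
  unfolding polys_in_iff using Poly_Mapping.keys_add[of f g] by blast

lemma polys_in_diff: "f \<in> polys_in A \<Longrightarrow> g \<in> polys_in A \<Longrightarrow> f - g \<in> polys_in A"
  unfolding polys_in_iff using keys_diff[of f g] by blast

lemma polys_in_mult: "f \<in> polys_in A \<Longrightarrow> g \<in> polys_in A \<Longrightarrow> f * g \<in> polys_in A"
  unfolding polys_in_iff using keys_mult[of f g] by (fastforce simp: keys_add_nat)

lemma ideal_gen_zero: "0 \<in> ideal_gen A G"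
  unfolding ideal_gen_def by (auto intro!: exI[of _ "{}"])

text \<open>A representation extends by zero cofactors to every finite superset of its support, so
  two representations can be written over a common index set and added.\<close>

lemma ideal_gen_superset:
  assumes "f \<in> ideal_gen A G"
  obtains F0 where "finite F0" "F0 \<subseteq> G"
    "\<forall>F. finite F \<longrightarrow> F0 \<subseteq> F \<longrightarrow> (\<exists>c. (\<forall>g\<in>F. c g \<in> polys_in A) \<and> f = (\<Sum>g\<in>F. c g * g))"
proof -
  from assms obtain F0 c where F0: "finite F0" "F0 \<subseteq> G" "\<forall>g\<in>F0. c g \<in> polys_in A"
    and f: "f = (\<Sum>g\<in>F0. c g * g)"
    unfolding ideal_gen_def by blast
  have "\<exists>c. (\<forall>g\<in>F. c g \<in> polys_in A) \<and> f = (\<Sum>g\<in>F. c g * g)"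
    if F: "finite F" "F0 \<subseteq> F" for F
  proof (intro exI conjI)
    let ?c = "\<lambda>g. if g \<in> F0 then c g else 0"
    show "\<forall>g\<in>F. ?c g \<in> polys_in A"
      using F0 by (auto simp: polys_in_zero)
    show "f = (\<Sum>g\<in>F. ?c g * g)"
      unfolding f using F by (intro sum.mono_neutral_cong_left) auto
  qed
  with F0 that show ?thesis by blast
qed

lemma ideal_gen_add:
  assumes "f \<in> ideal_gen A G" "g \<in> ideal_gen A G"
  shows "f + g \<in> ideal_gen A G"
proof -
  from ideal_gen_superset[OF assms(1)] obtain F1 where F1: "finite F1" "F1 \<subseteq> G"
    "\<forall>F. finite F \<longrightarrow> F1 \<subseteq> F \<longrightarrow> (\<exists>c. (\<forall>g\<in>F. c g \<in> polys_in A) \<and> f = (\<Sum>g\<in>F. c g * g))" .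
  from ideal_gen_superset[OF assms(2)] obtain F2 where F2: "finite F2" "F2 \<subseteq> G"
    "\<forall>F. finite F \<longrightarrow> F2 \<subseteq> F \<longrightarrow> (\<exists>c. (\<forall>g\<in>F. c g \<in> polys_in A) \<and> g = (\<Sum>g\<in>F. c g * g))" .
  have fin: "finite (F1 \<union> F2)"
    using F1 F2 by simp
  from F1(3) fin obtain c where c: "\<forall>g\<in>F1 \<union> F2. c g \<in> polys_in A" "f = (\<Sum>g\<in>F1 \<union> F2. c g * g)"
    by (meson Un_upper1)
  from F2(3) fin obtain c' where c': "\<forall>g\<in>F1 \<union> F2. c' g \<in> polys_in A" "g = (\<Sum>g\<in>F1 \<union> F2. c' g * g)"
    by (meson Un_upper2)
  have "f + g = (\<Sum>g\<in>F1 \<union> F2. (c g + c' g) * g)"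
    by (simp add: c(2) c'(2) sum.distrib distrib_right)
  moreover have "\<forall>g\<in>F1 \<union> F2. c g + c' g \<in> polys_in A"
    using c c' by (auto intro: polys_in_add)
  ultimately show ?thesis
    unfolding ideal_gen_def using F1 F2
    by (intro CollectI exI[of _ "F1 \<union> F2"] exI[of _ "\<lambda>g. c g + c' g"]) auto
qed

lemma ideal_gen_mult:
  assumes "f \<in> ideal_gen A G" "q \<in> polys_in A"
  shows "q * f \<in> ideal_gen A G"
proof -
  from assms(1) obtain F c where F: "finite F" "F \<subseteq> G" "\<forall>g\<in>F. c g \<in> polys_in A"
    and f: "f = (\<Sum>g\<in>F. c g * g)"
    unfolding ideal_gen_def by blast
  have "q * f = (\<Sum>g\<in>F. (q * c g) * g)"
    by (simp add: f sum_distrib_left mult.assoc)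
  with F assms(2) show ?thesis
    unfolding ideal_gen_def
    by (intro CollectI exI[of _ F] exI[of _ "\<lambda>g. q * c g"]) (auto intro: polys_in_mult)
qed

lemma ideal_gen_incl: "g \<in> G \<Longrightarrow> g \<in> ideal_gen A G"
  unfolding ideal_gen_def
  by (intro CollectI exI[of _ "{g}"] exI[of _ "\<lambda>_. 1"]) (auto simp: polys_in_one)

lemma ideal_gen_sum: "(\<And>x. x \<in> F \<Longrightarrow> f x \<in> ideal_gen A G) \<Longrightarrow> (\<Sum>x\<in>F. f x) \<in> ideal_gen A G"
  by (induction F rule: infinite_finite_induct) (simp_all add: ideal_gen_zero ideal_gen_add)

lemma ideal_gen_subset:
  assumes "H \<subseteq> ideal_gen A G"
  shows "ideal_gen A H \<subseteq> ideal_gen A G"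
proof
  fix f assume "f \<in> ideal_gen A H"
  then obtain F c where "F \<subseteq> H" "\<forall>g\<in>F. c g \<in> polys_in A" "f = (\<Sum>g\<in>F. c g * g)"
    unfolding ideal_gen_def by blast
  with assms show "f \<in> ideal_gen A G"
    by (auto intro!: ideal_gen_sum ideal_gen_mult)
qed

text \<open>A monomial of a sum occurs in some summand, and all monomials of \<open>c g * g\<close>
  are multiples of the monomial \<open>g\<close>.\<close>

lemma monomial_ideal_dvd:
  assumes "monomial t \<in> ideal_gen A (monomial ` M :: ('v, 'k::field) mpoly set)"
  obtains s where "s \<in> M" "monom_dvd s t"
proof -
  from assms obtain F and c :: "('v, 'k) mpoly \<Rightarrow> ('v, 'k) mpoly" where F: "F \<subseteq> monomial ` M"
    and f: "monomial t = (\<Sum>g\<in>F. c g * g)"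
    unfolding ideal_gen_def by blast
  have "lookup (\<Sum>g\<in>F. c g * g) t \<noteq> 0"
    unfolding f[symmetric] by (simp add: lookup_monomial)
  then obtain g where g: "g \<in> F" "t \<in> keys (c g * g)"
    unfolding lookup_sum in_keys_iff by (rule sum.not_neutral_contains_not_neutral) blast
  then obtain s where s: "s \<in> M" "g = monomial s"
    using F by blast
  have "keys (c g * g) \<subseteq> {u + v |u v. u \<in> keys (c g) \<and> v \<in> keys g}"
    by (rule keys_mult)
  with g(2) s obtain u where "t = u + s" by auto
  with s that show ?thesis
    unfolding monom_dvd_def by (metis add.commute)
qed

lemma monomial_ideal_memI:
  assumes "s \<in> M" "monom_dvd s t" "keys t \<subseteq> A"
  shows "monomial t \<in> ideal_gen A (monomial ` M)"
proof -
  from assms(2) obtain u where u: "t = s + u"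
    unfolding monom_dvd_def by blast
  with assms(3) have "keys u \<subseteq> A" by (simp add: keys_add_nat)
  then have "monomial u * monomial s \<in> ideal_gen A (monomial ` M)"
    using assms(1) by (intro ideal_gen_mult ideal_gen_incl polys_in_monomial) auto
  then show ?thesis by (simp add: monomial_mult u add.commute)
qed

section \<open>Groebner bases\<close>

lemma keys_lead_monom: "f \<in> polys_in A \<Longrightarrow> f \<noteq> 0 \<Longrightarrow> keys (lead_monom f) \<subseteq> A"
  using lead_monom_in_keys by (auto simp: polys_in_def)

text \<open>Both ideals are generated by monomials, so their equality reduces to divisibility
  between generators. Zero is excluded on both sides because its leading monomial is
  meaningless.\<close>

lemma groebner_basis_iff:
  fixes I G :: "(nat, 'k::field) mpoly set"
  assumes "I \<subseteq> polys_in A"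
  shows "groebner_basis A I G \<longleftrightarrow> finite G \<and> G \<subseteq> I \<and>
    (\<forall>f\<in>I - {0}. \<exists>g\<in>G - {0}. monom_dvd (lead_monom g) (lead_monom f))"
proof -
  have im: "(\<lambda>f. monomial (lead_monom f)) ` B = (monomial ` lead_monom ` B :: (nat, 'k) mpoly set)" for B
    by (simp add: image_image)
  have "ideal_gen A ((\<lambda>g. monomial (lead_monom g)) ` (G - {0})) = initial_ideal A I \<longleftrightarrow>
      (\<forall>f\<in>I - {0}. \<exists>g\<in>G - {0}. monom_dvd (lead_monom g) (lead_monom f))" if "G \<subseteq> I"
  proof
    assume eq: "ideal_gen A ((\<lambda>g. monomial (lead_monom g)) ` (G - {0})) = initial_ideal A I"
    show "\<forall>f\<in>I - {0}. \<exists>g\<in>G - {0}. monom_dvd (lead_monom g) (lead_monom f)"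
    proof
      fix f assume "f \<in> I - {0}"
      then have "monomial (lead_monom f) \<in> initial_ideal A I"
        unfolding initial_ideal_def by (intro ideal_gen_incl) auto
      then have "(monomial (lead_monom f) :: (nat, 'k) mpoly) \<in> ideal_gen A (monomial ` lead_monom ` (G - {0}))"
        by (simp add: eq[symmetric] im)
      then show "\<exists>g\<in>G - {0}. monom_dvd (lead_monom g) (lead_monom f)"
        by (rule monomial_ideal_dvd) (auto simp: image_iff)
    qed
  next
    assume dvd: "\<forall>f\<in>I - {0}. \<exists>g\<in>G - {0}. monom_dvd (lead_monom g) (lead_monom f)"
    let ?lm = "\<lambda>g. monomial (lead_monom g) :: (nat, 'k) mpoly"
    have "?lm ` (G - {0}) \<subseteq> ideal_gen A (?lm ` (I - {0}))"
      using that by (auto intro!: ideal_gen_incl)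
    moreover have "?lm f \<in> ideal_gen A (?lm ` (G - {0}))" if f: "f \<in> I" "f \<noteq> 0" for f
    proof -
      from dvd f obtain g where "g \<in> G - {0}" "monom_dvd (lead_monom g) (lead_monom f)" by blast
      then show ?thesis
        unfolding im using f assms keys_lead_monom by (intro monomial_ideal_memI[of "lead_monom g"]) auto
    qed
    then have "?lm ` (I - {0}) \<subseteq> ideal_gen A (?lm ` (G - {0}))" by auto
    ultimately show "ideal_gen A ((\<lambda>g. monomial (lead_monom g)) ` (G - {0})) = initial_ideal A I"
      unfolding initial_ideal_def by (simp add: ideal_gen_subset subset_antisym)
  qed
  then show ?thesis
    unfolding groebner_basis_def by blast
qed

text \<open>The division algorithm, run as an induction on the leading monomial. Only closure of
  \<open>I\<close> under differences and multiples enters, so it applies to a kernel without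
  presenting it as a generated ideal.\<close>

lemma groebner_basis_generates:
  assumes A: "finite A" and I: "I \<subseteq> polys_in A"
    and diff: "\<And>f g. f \<in> I \<Longrightarrow> g \<in> I \<Longrightarrow> f - g \<in> I"
    and mult: "\<And>f q. f \<in> I \<Longrightarrow> q \<in> polys_in A \<Longrightarrow> q * f \<in> I"
    and G: "groebner_basis A I G"
    and monic: "\<And>g. g \<in> G \<Longrightarrow> leading_coefficient g = 1"
  shows "I \<subseteq> ideal_gen A G"
proof -
  have dvd: "\<exists>g\<in>G - {0}. monom_dvd (lead_monom g) (lead_monom f)" if "f \<in> I" "f \<noteq> 0" for f
    using G that unfolding groebner_basis_iff[OF I] by blast
  have GI: "G \<subseteq> I"
    using G unfolding groebner_basis_def by blast
  have "\<forall>f\<in>I. f \<noteq> 0 \<longrightarrow> lead_monom f = t \<longrightarrow> f \<in> ideal_gen A G" if t: "keys t \<subseteq> A" for t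
  proof (rule drl_induct[OF A t])
    fix t
    assume step: "keys t \<subseteq> A" "\<And>s. keys s \<subseteq> A \<Longrightarrow> drl_less s t \<Longrightarrow>
        \<forall>f\<in>I. f \<noteq> 0 \<longrightarrow> lead_monom f = s \<longrightarrow> f \<in> ideal_gen A G"
    show "\<forall>f\<in>I. f \<noteq> 0 \<longrightarrow> lead_monom f = t \<longrightarrow> f \<in> ideal_gen A G"
    proof (intro ballI impI)
      fix f assume f: "f \<in> I" "f \<noteq> 0" "lead_monom f = t"
      from dvd[OF f(1,2)] obtain g u where g: "g \<in> G" "g \<noteq> 0" and u: "t = lead_monom g + u"
        using f(3) unfolding monom_dvd_def by blast
      from step(1) u have ku: "keys u \<subseteq> A" by (simp add: keys_add_nat)
      \<comment> \<open>As \<open>g\<close> is monic, \<open>q * g\<close> has the same leading term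
        as \<open>f\<close>, and the subtraction cancels it.\<close>
      define q where "q = single u (lookup f t)"
      have q: "q \<in> polys_in A"
        unfolding q_def using ku by (rule polys_in_single)
      have qg: "q * g \<in> I"
        using g GI q by (auto intro: mult)
      have look: "lookup (q * g) (u + v) = lookup f t * lookup g v" for v
      proof -
        have "lookup h w = linear_ext (\<lambda>x. if x = w then 1 else 0) h" for h :: "(nat, 'a) mpoly" and w
          by (simp add: linear_ext_def in_keys_iff if_distrib[of "\<lambda>x. _ * x"] sum.delta cong: if_cong)
        then show ?thesis
          unfolding q_def by (simp add: linear_ext_single_mult)
      qed
      have rI: "f - q * g \<in> I"
        using f(1) qg by (rule diff)
      have "f - q * g \<in> ideal_gen A G"
      proof (cases "f - q * g = 0")
        case False
        let ?l = "lead_monom (f - q * g)"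
        have "?l \<in> keys (f - q * g)"
          using False by (rule lead_monom_in_keys)
        then have ne: "lookup f ?l \<noteq> lookup (q * g) ?l"
          by (simp add: in_keys_iff lookup_minus)
        have "drl_less ?l t"
        proof (rule ccontr)
          assume *: "\<not> drl_less ?l t"
          show False
          proof (cases "?l = t")
            case True
            have "lookup g (lead_monom g) = 1"
              using monic[OF g(1)] by (simp add: leading_coefficient_def)
            then have "lookup (q * g) t = lookup f t"
              using look[of "lead_monom g"] by (simp add: u add.commute)
            with ne True show False by simp
          next
            case False
            \<comment> \<open>A term above \<open>t\<close> cannot come from \<open>f\<close>, so it
              comes from \<open>q * g\<close>; dividing by \<open>u\<close> yields a term of
              \<open>g\<close> above its leading monomial.\<close>
            with * drl_total have less: "drl_less t ?l" by blast
            then have "lookup f ?l = 0"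
              using f lookup_above_lead_monom by blast
            with ne have "?l \<in> keys (q * g)"
              by (simp add: in_keys_iff)
            then obtain v where v: "?l = u + v" "v \<in> keys g"
              using keys_mult[of q g] keys_single_subset[of u "lookup f t"] unfolding q_def by blast
            have "drl_less (lead_monom g) v"
              using less unfolding v(1) u add.commute[of "lead_monom g"] drl_add_iff .
            then show False
              using v(2) lookup_above_lead_monom[OF g(2)] by (simp add: in_keys_iff)
          qed
        qed
        moreover have "keys ?l \<subseteq> A"
          using rI I False keys_lead_monom by blast
        ultimately show ?thesis
          using step(2) rI False by blast
      qed (simp add: ideal_gen_zero)
      moreover have "q * g \<in> ideal_gen A G"
        using g(1) q by (intro ideal_gen_mult ideal_gen_incl)
      ultimately have "(f - q * g) + q * g \<in> ideal_gen A G"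
        by (rule ideal_gen_add)
      then show "f \<in> ideal_gen A G" by simp
    qed
  qed
  then have "f \<in> ideal_gen A G" if "f \<in> I" for f
    using that I keys_lead_monom[of f A] ideal_gen_zero[of A G] by (cases "f = 0") auto
  then show ?thesis by blast
qed

text \<open>
  The functionals \<open>\<phi>\<close> vanish on \<open>\<mm>I\<close>, with \<open>\<mm>\<close> generated by the variables, and are triangular
  with respect to the leading monomials, so \<open>G\<close> is linearly independent modulo \<open>\<mm>I\<close>.
\<close>

lemma no_proper_generating_subset:
  fixes G I :: "(nat, 'k::field) mpoly set"
  assumes GI: "G \<subseteq> I"
    and monic: "\<And>g. g \<in> G \<Longrightarrow> leading_coefficient g = 1"
    and inj: "inj_on lead_monom G"
    and \<phi>: "\<And>g. g \<in> G \<Longrightarrow> \<exists>\<phi>. \<phi> (lead_monom g) = 1 \<and>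
      (\<forall>t. drl_less t (lead_monom g) \<longrightarrow> \<phi> t = 0) \<and>
      (\<forall>u b. u \<noteq> 0 \<longrightarrow> keys u \<subseteq> A \<longrightarrow> b \<in> I \<longrightarrow> linear_ext (\<lambda>t. \<phi> (u + t)) b = 0)"
    and H: "H \<subset> G"
  shows "ideal_gen A H \<noteq> I"
proof
  assume "ideal_gen A H = I"
  obtain g where g: "g \<in> G" "g \<notin> H"
    using H by blast
  then have "g \<in> ideal_gen A H"
    using GI \<open>ideal_gen A H = I\<close> by blast
  then obtain F c where F: "finite F" "F \<subseteq> H" "\<forall>x\<in>F. c x \<in> polys_in A"
    and sum: "g = (\<Sum>x\<in>F. c x * x)"
    unfolding ideal_gen_def by blast
  have FG: "F \<subseteq> G" and gF: "g \<notin> F"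
    using F(2) H g by auto
  \<comment> \<open>Modulo mI only the constant coefficients of the cofactors survive.
    \<open>B\<close> collects the elements that really take part in the resulting relation. The
    functional is taken at the one with the greatest leading monomial, so that it kills all the
    others.\<close>
  define a where "a x = lookup (c x) 0" for x
  define B where "B = insert g {x \<in> F. a x \<noteq> 0}"
  have BG: "B \<subseteq> G"
    unfolding B_def using g FG by auto
  have "finite (lead_monom ` B)" "lead_monom ` B \<noteq> {}"
    using F(1) by (auto simp: B_def)
  then obtain x0 where x0: "x0 \<in> B"
    and max: "\<And>x. x \<in> B \<Longrightarrow> lead_monom x \<noteq> lead_monom x0 \<Longrightarrow> drl_less (lead_monom x) (lead_monom x0)"
    using drl_max_exists[of "lead_monom ` B"] by (metis (no_types, lifting) imageE imageI)
  from \<phi>[OF subsetD[OF BG x0]] obtain \<phi> :: "nat monom \<Rightarrow> 'k" where \<phi>0: "\<phi> (lead_monom x0) = 1" "\<forall>t. drl_less t (lead_monom x0) \<longrightarrow> \<phi> t = 0"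
    and \<phi>I: "\<forall>u b. u \<noteq> 0 \<longrightarrow> keys u \<subseteq> A \<longrightarrow> b \<in> I \<longrightarrow> linear_ext (\<lambda>t. \<phi> (u + t)) b = 0"
    by (elim exE conjE) (rule that)
  have nz: "x \<noteq> 0" if "x \<in> G" for x
    using monic[OF that] leading_coefficient_zero by (metis zero_neq_one)
  have other: "linear_ext \<phi> x = 0" if x: "x \<in> B" "x \<noteq> x0" for x
  proof -
    have "lead_monom x \<noteq> lead_monom x0"
      using inj x x0 BG by (auto dest: inj_onD)
    then have less: "drl_less (lead_monom x) (lead_monom x0)"
      using max x by blast
    have "\<phi> t = 0" if "t \<in> keys x" for t
      using \<phi>0(2) less drl_trans lead_monom_greatest[OF nz, of x t] that x(1) BG by (metis subsetD)
    then show ?thesis by (simp add: linear_ext_def)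
  qed
  have self: "linear_ext \<phi> x0 = 1"
  proof -
    have x0G: "x0 \<in> G" using x0 BG by blast
    have "linear_ext \<phi> x0 = (\<Sum>t\<in>{lead_monom x0}. lookup x0 t * \<phi> t)"
      unfolding linear_ext_def
      using lead_monom[OF nz[OF x0G]] \<phi>0(2) by (intro sum.mono_neutral_right) auto
    then show ?thesis
      using monic[OF x0G] \<phi>0(1) by (simp add: leading_coefficient_def)
  qed
  have summand: "linear_ext \<phi> (c x * x) = a x * linear_ext \<phi> x" if x: "x \<in> F" for x
  proof -
    have "linear_ext \<phi> (c x * x) = (\<Sum>u\<in>keys (c x). lookup (c x) u * linear_ext (\<lambda>t. \<phi> (u + t)) x)"
      by (rule linear_ext_mult)
    also have "\<dots> = (\<Sum>u\<in>keys (c x). if u = 0 then a x * linear_ext \<phi> x else 0)"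
    proof (rule sum.cong)
      fix u assume u: "u \<in> keys (c x)"
      show "lookup (c x) u * linear_ext (\<lambda>t. \<phi> (u + t)) x = (if u = 0 then a x * linear_ext \<phi> x else 0)"
      proof (cases "u = 0")
        case False
        have "keys u \<subseteq> A" using F(3) x u by (auto simp: polys_in_def)
        then have "linear_ext (\<lambda>t. \<phi> (u + t)) x = 0"
          using \<phi>I False x FG GI by blast
        with False show ?thesis by simp
      qed (simp add: a_def)
    qed simp
    also have "\<dots> = a x * linear_ext \<phi> x"
      by (auto simp: sum.delta in_keys_iff a_def)
    finally show ?thesis .
  qed
  have lin: "linear_ext \<phi> g = (\<Sum>x\<in>F. a x * linear_ext \<phi> x)"
    by (subst sum) (simp add: linear_ext_sum summand)
  show False
  proof (cases "x0 = g")
    case True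
    have "a x * linear_ext \<phi> x = 0" if "x \<in> F" for x
      using that gF True other[of x] by (cases "a x = 0") (auto simp: B_def)
    then have "(\<Sum>x\<in>F. a x * linear_ext \<phi> x) = 0"
      by (intro sum.neutral ballI)
    then show False
      using lin self True by simp
  next
    case False
    then have x0F: "x0 \<in> F" "a x0 \<noteq> 0"
      using x0 by (auto simp: B_def)
    have "a x * linear_ext \<phi> x = (if x = x0 then a x0 else 0)" if "x \<in> F" for x
      using that self other[of x] by (cases "a x = 0") (auto simp: B_def)
    then have "(\<Sum>x\<in>F. a x * linear_ext \<phi> x) = a x0"
      using F(1) x0F by (simp add: sum.delta)
    moreover have "linear_ext \<phi> g = 0"
      using other[of g] False by (simp add: B_def)
    ultimately show False
      using lin x0F by simp
  qed
qed

section \<open>The vanishing ideal in terms of fibers\<close>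

text \<open>This is the exponent of u in the image of the monomial; x_{n+1} contributes nothing to
  it.\<close>

definition weight :: "nat \<Rightarrow> (nat \<Rightarrow> nat) \<Rightarrow> nat monom \<Rightarrow> nat" where
  "weight n m = wdeg (\<lambda>i. if i = n + 1 then 0 else m i)"

text \<open>Degree and weight stand for the image monomial: the exponents of u and v add up to m_n
  times the degree.\<close>

definition same_fiber :: "nat \<Rightarrow> (nat \<Rightarrow> nat) \<Rightarrow> nat monom \<Rightarrow> nat monom \<Rightarrow> bool" where
  "same_fiber n m s t \<longleftrightarrow> monom_degree s = monom_degree t \<and> weight n m s = weight n m t"

lemma same_fiber_refl: "same_fiber n m t t"
  and same_fiber_sym: "same_fiber n m s t \<Longrightarrow> same_fiber n m t s"
  and same_fiber_trans: "same_fiber n m r s \<Longrightarrow> same_fiber n m s t \<Longrightarrow> same_fiber n m r t"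
  by (auto simp: same_fiber_def)

lemma weight_add: "weight n m (s + t) = weight n m s + weight n m t"
  by (simp add: weight_def wdeg_add)

lemma same_fiber_add_iff: "same_fiber n m (u + s) (u + t) \<longleftrightarrow> same_fiber n m s t"
  by (simp add: same_fiber_def monom_degree_add weight_add)

text \<open>Each variable contributes m_n to the joint exponent of u and v. The exponent of v is
  pinned down by an equation instead of a difference, which keeps truncated subtraction out of the
  later arguments.\<close>

lemma poly_subst_curve_param:
  fixes t :: "nat monom"
  assumes "keys t \<subseteq> {k..n+1}" "\<forall>i\<in>{k..n}. m i \<le> m n"
  obtains v where "v + weight n m t = m n * monom_degree t"
    and "(\<Prod>i\<in>keys t. curve_param n m i ^ lookup t i :: (uv, 'k::field) mpoly)
      = monomial (single U_var (weight n m t) + single V_var v)"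
proof
  let ?v = "\<lambda>i. if i = n + 1 then m n else m n - m i"
  have "wdeg ?v t + weight n m t = (\<Sum>i\<in>keys t. lookup t i * m n)"
    unfolding weight_def wdeg_def sum.distrib[symmetric]
  proof (rule sum.cong)
    fix i assume "i \<in> keys t"
    with assms(1) have "i = n + 1 \<or> i \<in> {k..n}" by force
    with assms(2) show "lookup t i * ?v i + lookup t i * (if i = n + 1 then 0 else m i) = lookup t i * m n"
      by (auto simp flip: distrib_left)
  qed simp
  then show "wdeg ?v t + weight n m t = m n * monom_degree t"
    by (simp add: monom_degree_def sum_distrib_left mult.commute)
  have "curve_param n m i ^ lookup t i = (monomial (single U_var (lookup t i * (if i = n + 1 then 0 else m i))
      + single V_var (lookup t i * ?v i)) :: (uv, 'k) mpoly)" for i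
  proof -
    have "(X U_var ^ a * X V_var ^ b) ^ c
        = (monomial (single U_var (c * a) + single V_var (c * b)) :: (uv, 'k) mpoly)" for a b c
      unfolding power_mult_distrib unfolding power_mult[symmetric] unfolding X_power monomial_mult
      by (simp add: mult.commute)
    from this[of 0 "m n"] this[of "m i" "m n - m i"] show ?thesis
      by (simp add: curve_param_def)
  qed
  moreover have "(\<Prod>i\<in>B. monomial (single U_var (f i) + single V_var (g i)) :: (uv, 'k) mpoly)
      = monomial (single U_var (sum f B) + single V_var (sum g B))" if "finite B" for f g and B :: "nat set"
    using that by (induction B rule: finite_induct)
      (simp_all add: monomial_zero monomial_mult single_add algebra_simps)
  ultimately show "(\<Prod>i\<in>keys t. curve_param n m i ^ lookup t i :: (uv, 'k) mpoly)
      = monomial (single U_var (weight n m t) + single V_var (wdeg ?v t))"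
    unfolding weight_def wdeg_def by simp
qed

lemma lookup_uv:
  "lookup (single U_var a + single V_var b) U_var = (a :: nat)"
  "lookup (single U_var a + single V_var b) V_var = (b :: nat)"
  by (simp_all add: lookup_add lookup_single when_def)

lemma uv_cases: "q = single U_var (lookup q U_var) + single V_var (lookup q V_var :: nat)"
proof (rule poly_mapping_eqI)
  fix x :: uv
  show "lookup q x = lookup (single U_var (lookup q U_var) + single V_var (lookup q V_var)) x"
    by (cases x) (simp_all add: lookup_uv)
qed

text \<open>Each coefficient of the image collects the coefficients of \<open>f\<close> over one
  fiber, and different fibers have different images.\<close>

lemma curve_ideal_iff:
  fixes f :: "(nat, 'k::field) mpoly"
  assumes m: "\<forall>i\<in>{k..n}. m i \<le> m n" and mn: "m n > 0"
  shows "f \<in> curve_ideal k n m \<longleftrightarrow> f \<in> polys_in {k..n+1} \<and>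
    (\<forall>D w. linear_ext (\<lambda>t. if monom_degree t = D \<and> weight n m t = w then 1 else 0) f = 0)"
proof (cases "f \<in> polys_in {k..n+1}")
  case True
  let ?P = "\<lambda>t. \<Prod>i\<in>keys t. curve_param n m i ^ lookup t i :: (uv, 'k) mpoly"
  let ?\<phi> = "\<lambda>D w t. if monom_degree t = D \<and> weight n m t = w then 1 else 0 :: 'k"
  have *: "lookup (?P t) (single U_var w + single V_var v)
      = (if weight n m t = w \<and> v + w = m n * monom_degree t then 1 else (0 :: 'k))" if t: "t \<in> keys f" for t w and v :: nat
  proof -
    have kt: "keys t \<subseteq> {k..n+1}" using True t by (auto simp: polys_in_def)
    obtain v' where v': "v' + weight n m t = m n * monom_degree t"
      "?P t = monomial (single U_var (weight n m t) + single V_var v')"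
      using poly_subst_curve_param[where ?'k = 'k, OF kt m] by metis
    have "(single U_var (weight n m t) + single V_var v' = single U_var w + single V_var v)
        \<longleftrightarrow> weight n m t = w \<and> v' = v"
      by (metis lookup_uv)
    then show ?thesis
      unfolding v'(2) lookup_monomial using v'(1) by auto
  qed
  have const: "lookup (Const c * r) q = c * lookup r q" for c :: 'k and r :: "(uv, 'k) mpoly" and q
  proof -
    have "lookup h x = linear_ext (\<lambda>y. if y = x then 1 else 0) h" for h :: "(uv, 'k) mpoly" and x
      by (simp add: linear_ext_def in_keys_iff if_distrib[of "\<lambda>x. _ * x"] sum.delta cong: if_cong)
    then show ?thesis
      unfolding Const_def by (simp add: linear_ext_single_mult)
  qed
  have look: "lookup (poly_subst (curve_param n m) f) (single U_var w + single V_var v)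
      = linear_ext (\<lambda>t. if weight n m t = w \<and> v + w = m n * monom_degree t then 1 else 0) f" for v w
    unfolding poly_subst_def lookup_sum const linear_ext_def by (intro sum.cong) (simp_all add: *)
  have "poly_subst (curve_param n m) f = 0 \<longleftrightarrow> (\<forall>D w. linear_ext (?\<phi> D w) f = 0)"
  proof
    assume 0: "poly_subst (curve_param n m) f = 0"
    show "\<forall>D w. linear_ext (?\<phi> D w) f = 0"
    proof (intro allI)
      fix D w
      have le: "weight n m t \<le> m n * monom_degree t" if "t \<in> keys f" for t
      proof -
        have "keys t \<subseteq> {k..n+1}" using True that by (auto simp: polys_in_def)
        from poly_subst_curve_param[where ?'k = 'k, OF this m] show ?thesis by (metis le_add2)
      qed
      \<comment> \<open>For w > m_n D the truncated difference would be wrong, but then no monomial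
        of \<open>f\<close> has this degree and weight and the sum is empty.\<close>
      have "linear_ext (?\<phi> D w) f
          = linear_ext (\<lambda>t. if weight n m t = w \<and> (m n * D - w) + w = m n * monom_degree t then 1 else 0) f
          \<or> linear_ext (?\<phi> D w) f = 0"
      proof (cases "w \<le> m n * D")
        case True
        with mn show ?thesis
          by (intro disjI1 linear_ext_cong) auto
      next
        case False
        then have "?\<phi> D w t = 0" if "t \<in> keys f" for t
          using le[OF that] by auto
        then show ?thesis by (simp add: linear_ext_def)
      qed
      then show "linear_ext (?\<phi> D w) f = 0"
        using look[of w "m n * D - w"] 0 by auto
    qed
  next
    assume 0: "\<forall>D w. linear_ext (?\<phi> D w) f = 0"
    show "poly_subst (curve_param n m) f = 0"
    proof (rule poly_mapping_eqI)
      fix q :: "uv \<Rightarrow>\<^sub>0 nat"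
      define w v where "w = lookup q U_var" and "v = lookup q V_var"
      have "linear_ext (\<lambda>t. if weight n m t = w \<and> v + w = m n * monom_degree t then 1 else 0) f = 0"
      \<comment> \<open>Monomials in u and v whose total degree is not a multiple of m_n are never
        hit.\<close>
      proof (cases "m n dvd v + w")
        case True
        then obtain D where D: "v + w = m n * D" by blast
        have "linear_ext (\<lambda>t. if weight n m t = w \<and> v + w = m n * monom_degree t then 1 else 0) f
            = linear_ext (?\<phi> D w) f"
          using mn by (intro linear_ext_cong) (auto simp: D)
        with 0 show ?thesis by simp
      next
        case False
        then have "v + w \<noteq> m n * monom_degree t" for t :: "nat monom"
          by (metis dvd_triv_left)
        then show ?thesis by (simp add: linear_ext_def)
      qed
      then show "lookup (poly_subst (curve_param n m) f) q = lookup 0 q"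
        using look[of w v] uv_cases[of q] by (simp add: w_def v_def)
    qed
  qed
  with True show ?thesis by (simp add: curve_ideal_def)
qed (simp add: curve_ideal_def)

lemma curve_ideal_subset: "k \<le> l \<Longrightarrow> curve_ideal l n m \<subseteq> curve_ideal k n m"
proof -
  assume "k \<le> l"
  then have "{l..n+1} \<subseteq> {k..n+1}" by auto
  then show ?thesis
    unfolding curve_ideal_def polys_in_def by blast
qed

lemma curve_ideal_fiber_sum:
  fixes f :: "(nat, 'k::field) mpoly"
  assumes "\<forall>i\<in>{k..n}. m i \<le> m n" "m n > 0" "f \<in> curve_ideal k n m"
  shows "linear_ext (\<lambda>t. if same_fiber n m s t then 1 else 0) f = 0"
proof -
  have "(\<lambda>t. if same_fiber n m s t then 1 else 0 :: 'k)
      = (\<lambda>t. if monom_degree t = monom_degree s \<and> weight n m t = weight n m s then 1 else 0)"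
    by (auto simp: same_fiber_def fun_eq_iff)
  then show ?thesis
    using assms curve_ideal_iff[OF assms(1,2), of f] by simp
qed

lemma curve_ideal_diff:
  fixes f g :: "(nat, 'k::field) mpoly"
  assumes "\<forall>i\<in>{k..n}. m i \<le> m n" "m n > 0" "f \<in> curve_ideal k n m" "g \<in> curve_ideal k n m"
  shows "f - g \<in> curve_ideal k n m"
  using assms(3,4) unfolding curve_ideal_iff[OF assms(1,2)] by (simp add: linear_ext_diff polys_in_diff)

lemma curve_ideal_mult:
  fixes f q :: "(nat, 'k::field) mpoly"
  assumes "\<forall>i\<in>{k..n}. m i \<le> m n" "m n > 0" "f \<in> curve_ideal k n m" "q \<in> polys_in {k..n+1}"
  shows "q * f \<in> curve_ideal k n m"
proof -
  have "linear_ext (\<lambda>t. if monom_degree t = D \<and> weight n m t = w then 1 else 0) (q * f) = 0" for D w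
  proof -
    have "linear_ext (\<lambda>t. if monom_degree (u + t) = D \<and> weight n m (u + t) = w then 1 else 0) f = 0" for u
    proof (cases "monom_degree u \<le> D \<and> weight n m u \<le> w")
      case True
      then have "(\<lambda>t. if monom_degree (u + t) = D \<and> weight n m (u + t) = w then 1 else (0 :: 'k))
          = (\<lambda>t. if monom_degree t = D - monom_degree u \<and> weight n m t = w - weight n m u then 1 else 0)"
        by (intro ext) (auto simp: monom_degree_add weight_add)
      then show ?thesis
        using assms(3) curve_ideal_iff[OF assms(1,2), of f] by simp
    next
      case False
      then have "(\<lambda>t. if monom_degree (u + t) = D \<and> weight n m (u + t) = w then 1 else (0 :: 'k)) = (\<lambda>t. 0)"
        by (intro ext) (auto simp: monom_degree_add weight_add)
      then show ?thesis by (simp add: linear_ext_def)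
    qed
    then show ?thesis by (simp add: linear_ext_mult)
  qed
  with assms(3,4) show ?thesis
    unfolding curve_ideal_iff[OF assms(1,2)] by (simp add: polys_in_mult)
qed

lemma curve_ideal_binomial:
  assumes "\<forall>i\<in>{k..n}. m i \<le> m n" "m n > 0" "same_fiber n m s t"
    and "keys s \<subseteq> {k..n+1}" "keys t \<subseteq> {k..n+1}"
  shows "(monomial t - monomial s :: (nat, 'k::field) mpoly) \<in> curve_ideal k n m"
  using assms(3-5) unfolding curve_ideal_iff[OF assms(1,2)]
  by (auto simp: linear_ext_diff same_fiber_def intro!: polys_in_diff polys_in_monomial)

text \<open>If the leading monomial were alone in its fiber within the support, the fiber sum would
  be its nonzero coefficient.\<close>

lemma curve_ideal_reducible:
  fixes f :: "(nat, 'k::field) mpoly"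
  assumes "\<forall>i\<in>{k..n}. m i \<le> m n" "m n > 0" "f \<in> curve_ideal k n m" "f \<noteq> 0"
  obtains s where "keys s \<subseteq> {k..n+1}" "drl_less s (lead_monom f)" "same_fiber n m (lead_monom f) s"
proof -
  let ?t = "lead_monom f"
  have t: "?t \<in> keys f"
    using assms(4) by (rule lead_monom_in_keys)
  have "\<exists>s\<in>keys f. s \<noteq> ?t \<and> same_fiber n m ?t s"
  proof (rule ccontr)
    assume *: "\<not> ?thesis"
    have "linear_ext (\<lambda>u. if same_fiber n m ?t u then 1 else 0) f
        = (\<Sum>u\<in>{?t}. lookup f u * (if same_fiber n m ?t u then 1 else 0))"
      unfolding linear_ext_def using t * by (intro sum.mono_neutral_right) auto
    also have "\<dots> = lookup f ?t"
      by (simp add: same_fiber_refl)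
    finally show False
      using curve_ideal_fiber_sum[OF assms(1-3), of ?t] t by (simp add: in_keys_iff)
  qed
  then obtain s where s: "s \<in> keys f" "s \<noteq> ?t" "same_fiber n m ?t s" by blast
  have "keys s \<subseteq> {k..n+1}"
    using assms(3) s(1) by (auto simp: curve_ideal_def polys_in_def)
  with s lead_monom_greatest[OF assms(4) s(1,2)] that show ?thesis by blast
qed

section \<open>Almost arithmetic sequences\<close>

lemma lookup_conv_wdeg: "lookup t j = wdeg (\<lambda>i. if i = j then 1 else 0) t"
  by (simp add: wdeg_def in_keys_iff if_distrib[of "\<lambda>x. _ * x"] sum.delta cong: if_cong)

lemma wdeg_plus: "wdeg (\<lambda>i. f i + g i) t = wdeg f t + wdeg g t"
  by (simp add: wdeg_def distrib_left sum.distrib)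

lemma wdeg_cmult: "wdeg (\<lambda>i. c * f i) t = c * wdeg f t"
  by (simp add: wdeg_def sum_distrib_left algebra_simps)

lemma wdeg_cong: "(\<And>i. i \<in> keys t \<Longrightarrow> f i = g i) \<Longrightarrow> wdeg f t = wdeg g t"
  by (simp add: wdeg_def)

lemma wdeg_mono: "(\<And>i. i \<in> keys t \<Longrightarrow> f i \<le> g i) \<Longrightarrow> wdeg f t \<le> wdeg g t"
  unfolding wdeg_def by (intro sum_mono mult_left_mono) auto

text \<open>R <= T reads l <= k(a+e), which forces k >= 1; T <= RN reads k(a+eN) <= (N-1)b + lN,
  where k may then be lowered to 1. Every lower bound on an exponent of x_2 comes from here. The
  sign of \<open>l\<close> is opposite to that in \<open>weight_params\<close>: it counts the
  factors x_1^h given up.\<close>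

lemma arithmetic_fiber_bound:
  fixes a e N b l k R T :: int
  assumes pos: "a > 0" "e > 0" "N > 0" and "l \<ge> 1"
    and T: "T = b + k * a" and R: "R = b + l - k * e" and bounds: "R \<le> T" "T \<le> R * N"
  shows "k \<ge> 1" "a + e * N - l * N \<le> (N - 1) * b"
proof -
  have "l \<le> k * (a + e)"
    using bounds T R by (simp add: algebra_simps)
  then have "0 < k * (a + e)" using \<open>l \<ge> 1\<close> by simp
  then show k: "k \<ge> 1" using pos by (simp add: zero_less_mult_iff)
  have "1 * (a + e * N) \<le> k * (a + e * N)"
    using k pos by (intro mult_right_mono) auto
  moreover have "b + k * a \<le> (b + l - k * e) * N"
    using bounds T R by simp
  ultimately show "a + e * N - l * N \<le> (N - 1) * b"
    by (simp add: algebra_simps)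
qed

locale almost_arithmetic =
  fixes n h d p s :: nat and m :: "nat \<Rightarrow> nat"
  assumes n: "n \<ge> 3"
    and m_pos: "\<forall>i\<in>{1..n}. m i > 0"
    and m_mono: "strict_mono_on {1..n} m"
    and m_def: "\<forall>i\<in>{2..n}. m i = h * m 1 + (i - 1) * d"
    and h: "h > 1" and d: "d > 0"
    and coprime: "gcd (m 1) d = 1"
    and h_dvd: "h dvd d"
    and p_s: "s \<in> {1..n-1}" "m 1 = p * (n - 1) + s"
begin

definition e where "e = d div h"

abbreviation fib where "fib \<equiv> same_fiber n m"

text \<open>The tail consists of x_2, ..., x_n. In \<open>tail_weight\<close>, x_i counts i-1, its
  number of steps e above m_1; the two statistics agree exactly on x_2.\<close>

definition tail_count where "tail_count = wdeg (\<lambda>i. if 2 \<le> i \<and> i \<le> n then 1 else 0)"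

definition tail_weight where "tail_weight = wdeg (\<lambda>i. if 2 \<le> i \<and> i \<le> n then i - 1 else 0)"

lemma d_eq: "h * e = d"
  using h_dvd by (simp add: e_def)

lemma e_pos: "e > 0"
  using d d_eq by (cases "e = 0") auto

lemma coprime_e: "coprime (m 1) e" and coprime_h: "coprime (m 1) h"
proof -
  have "coprime (m 1) (h * e)"
    using coprime by (simp add: d_eq coprime_iff_gcd_eq_1)
  then show "coprime (m 1) e" "coprime (m 1) h"
    by simp_all
qed

lemma m1_pos: "m 1 > 0"
  using m_pos n by auto

lemma m_eq: "2 \<le> i \<Longrightarrow> i \<le> n \<Longrightarrow> m i = h * (m 1 + (i - 1) * e)"
  using m_def by (simp add: distrib_left mult.left_commute[of h] d_eq)

lemma m_le: "\<forall>i\<in>{1..n}. m i \<le> m n"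
  using m_mono n by (auto simp: strict_mono_on_def le_less)

lemma m_le2: "\<forall>i\<in>{2..n}. m i \<le> m n"
  using m_le by auto

lemma mn_pos: "m n > 0"
  using m_pos n by auto

lemma weight_inj: "inj_on (\<lambda>i. if i = n + 1 then 0 else m i) {1..n+1}"
proof -
  have "inj_on m {1..n}"
    using m_mono by (rule strict_mono_on_imp_inj_on)
  then have inj: "m x = m y \<Longrightarrow> x = y" if "x \<in> {1..n}" "y \<in> {1..n}" for x y
    using that by (simp add: inj_on_eq_iff)
  have in_range: "x \<in> {1..n}" if "x \<in> {1..n+1}" "x \<noteq> n + 1" for x
    using that by auto
  show ?thesis
  proof (rule inj_onI)
    fix x y
    assume xy: "x \<in> {1..n+1}" "y \<in> {1..n+1}" "(if x = n + 1 then 0 else m x) = (if y = n + 1 then 0 else m y)"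
    show "x = y"
    proof (cases "x = n + 1 \<or> y = n + 1")
      case True
      have "m z > 0" if "z \<in> {1..n+1}" "z \<noteq> n + 1" for z
        using m_pos in_range[OF that] by blast
      with True xy show ?thesis
        by (metis less_irrefl)
    next
      case False
      then have "x \<in> {1..n}" "y \<in> {1..n}"
        using xy(1,2) in_range by blast+
      moreover have "m x = m y"
        using xy(3) False by simp
      ultimately show ?thesis by (rule inj)
    qed
  qed
qed

lemma delta_div: "delta h d p div h = p + e + 1"
proof -
  have "delta h d p = h * (p + e + 1)"
    by (simp add: delta_def d_eq distrib_left mult.commute)
  then show ?thesis using h by simp
qed

lemma tail_count_add: "tail_count (t + u) = tail_count t + tail_count u"
  and tail_weight_add: "tail_weight (t + u) = tail_weight t + tail_weight u"
  by (simp_all add: tail_count_def tail_weight_def wdeg_add)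

lemma tail_single:
  "tail_count (single i k) = (if 2 \<le> i \<and> i \<le> n then k else 0)"
  "tail_weight (single i k) = (if 2 \<le> i \<and> i \<le> n then k * (i - 1) else 0)"
  by (simp_all add: tail_count_def tail_weight_def)

lemma tail_zero [simp]: "tail_count 0 = 0" "tail_weight 0 = 0"
  by (simp_all add: tail_count_def tail_weight_def)

lemma tail_bounds:
  "tail_count t \<le> tail_weight t" "tail_weight t \<le> tail_count t * (n - 1)"
proof -
  show "tail_count t \<le> tail_weight t"
    unfolding tail_count_def tail_weight_def by (intro wdeg_mono) auto
  have "tail_weight t \<le> wdeg (\<lambda>i. (n - 1) * (if 2 \<le> i \<and> i \<le> n then 1 else 0)) t"
    unfolding tail_weight_def by (intro wdeg_mono) auto
  then show "tail_weight t \<le> tail_count t * (n - 1)"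
    unfolding tail_count_def wdeg_cmult by (simp add: mult.commute)
qed

lemma degree_eq:
  assumes "keys t \<subseteq> {1..n+1}"
  shows "monom_degree t = lookup t 1 + tail_count t + lookup t (n + 1)"
proof -
  have "monom_degree t = wdeg (\<lambda>i. ((if i = 1 then 1 else 0) + (if 2 \<le> i \<and> i \<le> n then 1 else 0))
      + (if i = n + 1 then 1 else 0)) t"
    unfolding monom_degree_conv_wdeg using assms n by (intro wdeg_cong) force
  then show ?thesis
    unfolding wdeg_plus lookup_conv_wdeg tail_count_def .
qed

lemma weight_eq:
  assumes "keys t \<subseteq> {1..n+1}"
  shows "weight n m t = lookup t 1 * m 1 + h * (tail_count t * m 1 + tail_weight t * e)"
proof -
  have "weight n m t = wdeg (\<lambda>i. m 1 * (if i = 1 then 1 else 0)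
      + (h * m 1 * (if 2 \<le> i \<and> i \<le> n then 1 else 0) + h * e * (if 2 \<le> i \<and> i \<le> n then i - 1 else 0))) t"
    unfolding weight_def
  proof (rule wdeg_cong)
    fix i assume "i \<in> keys t"
    with assms have "i \<in> {1..n+1}" by blast
    then consider "i = 1" | "2 \<le> i" "i \<le> n" | "i = n + 1" by fastforce
    then show "(if i = n + 1 then 0 else m i) = m 1 * (if i = 1 then 1 else 0)
      + (h * m 1 * (if 2 \<le> i \<and> i \<le> n then 1 else 0) + h * e * (if 2 \<le> i \<and> i \<le> n then i - 1 else 0))"
      using n by cases (auto simp: m_eq algebra_simps)
  qed
  then show ?thesis
    unfolding wdeg_plus wdeg_cmult lookup_conv_wdeg[of t 1] tail_count_def tail_weight_def
    by (simp add: algebra_simps)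
qed

text \<open>Modulo h, coprimality of m_1 and h gives h | y - x. After cancelling h, coprimality of
  m_1 and e gives m_1 | T' - T. The quotients are \<open>l\<close> and \<open>k\<close>. The
  statement is about numbers so that it also serves for semigroup elements.\<close>

lemma weight_params:
  fixes x y R T R' T' :: nat
  assumes "x * m 1 + h * (R * m 1 + T * e) = y * m 1 + h * (R' * m 1 + T' * e)"
  obtains k l :: int where
    "int y = int x + l * int h" "int T' = int T + k * int (m 1)" "int R' = int R - l - k * int e"
proof -
  have "int (x * m 1 + h * (R * m 1 + T * e)) = int (y * m 1 + h * (R' * m 1 + T' * e))"
    using assms by simp
  then have eq: "(int y - int x) * int (m 1)
      = int h * ((int R - int R') * int (m 1) + (int T - int T') * int e)"
    by (simp add: algebra_simps)
  then have "int h dvd (int y - int x) * int (m 1)"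
    by simp
  moreover have "Rings.coprime (int h) (int (m 1))"
    using coprime_h by (simp add: coprime_commute)
  ultimately have "int h dvd int y - int x"
    by (simp add: coprime_dvd_mult_left_iff)
  then obtain l where l: "int y - int x = int h * l" by blast
  with eq have "int h * (l * int (m 1)) = int h * ((int R - int R') * int (m 1) + (int T - int T') * int e)"
    by (simp add: algebra_simps)
  then have "l * int (m 1) = (int R - int R') * int (m 1) + (int T - int T') * int e"
    using h by simp
  then have eq3: "(int T' - int T) * int e = int (m 1) * (int R - int R' - l)"
    by (simp add: algebra_simps)
  then have "int (m 1) dvd (int T' - int T) * int e"
    by simp
  moreover have "Rings.coprime (int (m 1)) (int e)"
    using coprime_e by simp
  ultimately have "int (m 1) dvd int T' - int T"
    by (simp add: coprime_dvd_mult_left_iff)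
  then obtain k where k: "int T' - int T = int (m 1) * k" by blast
  with eq3 have "int (m 1) * (k * int e) = int (m 1) * (int R - int R' - l)"
    by (simp add: algebra_simps)
  then have "k * int e = int R - int R' - l"
    using m1_pos by simp
  then show ?thesis
    using l k by (intro that[of l k]) (simp_all add: algebra_simps)
qed

lemma fiber_params:
  assumes "keys t \<subseteq> {1..n+1}" "keys u \<subseteq> {1..n+1}" "fib t u"
  obtains k l :: int where
    "int (lookup u 1) = int (lookup t 1) + l * int h"
    "int (tail_weight u) = int (tail_weight t) + k * int (m 1)"
    "int (tail_count u) = int (tail_count t) - l - k * int e"
    "lookup t 1 + tail_count t + lookup t (n + 1) = lookup u 1 + tail_count u + lookup u (n + 1)"
proof -
  have deg: "lookup t 1 + tail_count t + lookup t (n + 1) = lookup u 1 + tail_count u + lookup u (n + 1)"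
    using assms by (simp add: same_fiber_def degree_eq)
  have "lookup t 1 * m 1 + h * (tail_count t * m 1 + tail_weight t * e)
      = lookup u 1 * m 1 + h * (tail_count u * m 1 + tail_weight u * e)"
    using assms by (simp add: same_fiber_def weight_eq)
  then show ?thesis
    by (rule weight_params) (rule that[OF _ _ _ deg])
qed

lemma fiberI:
  assumes "keys t \<subseteq> {1..n+1}" "keys u \<subseteq> {1..n+1}"
    and "int (lookup u 1) = int (lookup t 1) + l * int h"
    and "int (tail_weight u) = int (tail_weight t) + k * int (m 1)"
    and "int (tail_count u) = int (tail_count t) - l - k * int e"
    and "lookup t 1 + tail_count t + lookup t (n + 1) = lookup u 1 + tail_count u + lookup u (n + 1)"
  shows "fib t u"
proof -
  have "int (weight n m t) = int (weight n m u)"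
    unfolding weight_eq[OF assms(1)] weight_eq[OF assms(2)] of_nat_add of_nat_mult
    unfolding assms(3-5) by (simp add: algebra_simps)
  moreover have "monom_degree t = monom_degree u"
    unfolding degree_eq[OF assms(1)] degree_eq[OF assms(2)] by (rule assms(6))
  ultimately show ?thesis by (simp add: same_fiber_def)
qed

text \<open>Converse of \<open>tail_bounds\<close>, by a greedy choice of variables.\<close>

lemma tail_realizable:
  assumes "r \<le> w" "w \<le> r * (n - 1)"
  obtains u where "keys u \<subseteq> {2..n}" "tail_count u = r" "tail_weight u = w"
proof -
  have "\<exists>u. keys u \<subseteq> {2..n} \<and> tail_count u = r \<and> tail_weight u = w"
    using assms
  proof (induction r arbitrary: w)
    case (Suc r)
    \<comment> \<open>The largest step that still leaves weight at least 1 for each of the other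
      \<open>r\<close> factors; it belongs to the variable with index \<open>q + 1\<close>.\<close>
    define q where "q = min (n - 1) (w - r)"
    have q: "1 \<le> q" "q \<le> n - 1" "q \<le> w" "r \<le> w - q" "w - q \<le> r * (n - 1)"
      using Suc.prems n by (auto simp: q_def min_def)
    from Suc.IH[OF q(4,5)] obtain u where u: "keys u \<subseteq> {2..n}" "tail_count u = r" "tail_weight u = w - q"
      by blast
    have "keys (u + single (q + 1) 1) \<subseteq> {2..n}"
      using u(1) q n by (auto simp: keys_add_nat)
    moreover have "tail_count (u + single (q + 1) 1) = Suc r" "tail_weight (u + single (q + 1) 1) = w"
      using u q n by (simp_all add: tail_count_add tail_weight_add tail_single)
    ultimately show ?case by blast
  qed (auto intro: exI[of _ 0])
  with that show ?thesis by blast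
qed


section \<open>The numbers beta_j, sigma_j and lambda_j\<close>

text \<open>The lower bound for beta_j. The representation by m_3, ..., m_n has its own R and T;
  compared with jh m_1 + b m_2 it is a shift with l = -j, to which
  \<open>arithmetic_fiber_bound\<close> applies.\<close>

lemma tail_semigroup_bound:
  assumes "1 \<le> j" "(j * h) * m 1 + b * m 2 \<in> tail_semigroup n m"
  shows "int (m 1) + int e * int (n - 1) - int j * int (n - 1) \<le> (int (n - 1) - 1) * int b"
proof -
  from assms(2) obtain c where c: "(j * h) * m 1 + b * m 2 = (\<Sum>i=3..n. c i * m i)"
    unfolding tail_semigroup_def by blast
  let ?R = "\<Sum>i=3..n. c i" and ?T = "\<Sum>i=3..n. c i * (i - 1)"
  have "(\<Sum>i=3..n. c i * m i) = (\<Sum>i=3..n. h * (c i * m 1 + c i * (i - 1) * e))"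
    by (intro sum.cong) (auto simp: m_eq algebra_simps)
  also have "\<dots> = h * (?R * m 1 + ?T * e)"
    by (simp flip: sum_distrib_left sum_distrib_right add: sum.distrib)
  finally have "(j * h) * m 1 + h * (b * m 1 + b * e) = 0 * m 1 + h * (?R * m 1 + ?T * e)"
    using c m_eq[of 2] n by (simp add: algebra_simps)
  then obtain k l where kl: "int 0 = int (j * h) + l * int h"
    "int ?T = int b + k * int (m 1)" "int ?R = int b - l - k * int e"
    by (rule weight_params)
  have "(int j + l) * int h = 0"
    using kl(1) by (simp add: algebra_simps)
  then have "l = - int j"
    using h by simp
  with kl have R: "int ?R = int b + int j - k * int e"
    by simp
  have "?R \<le> ?T"
    by (intro sum_mono) auto
  then have le1: "int ?R \<le> int ?T"
    by (simp only: of_nat_le_iff)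
  have "?T \<le> ?R * (n - 1)"
    unfolding sum_distrib_right by (intro sum_mono mult_left_mono diff_le_mono) auto
  then have le2: "int ?T \<le> int ?R * int (n - 1)"
    by (metis of_nat_le_iff of_nat_mult)
  show ?thesis
    using m1_pos e_pos n assms(1)
    by (intro arithmetic_fiber_bound(2)[OF _ _ _ _ kl(2) R le1 le2]) auto
qed

lemma weight_pair:
  assumes "2 \<le> sig" "sig \<le> n"
  shows "m sig + lam * m n = h * ((1 + lam) * m 1 + ((sig - 1) + lam * (n - 1)) * e)"
proof -
  have "h * (a + x * e) + lam * (h * (a + y * e)) = h * ((1 + lam) * a + (x + lam * y) * e)" for a x y :: nat
    by (simp add: algebra_simps)
  then show ?thesis
    using assms n by (simp only: m_eq)
qed

text \<open>The two numerical hypotheses describe the shift l = -j, k = 1 starting from x_1^(jh)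
  x_2^b.\<close>

lemma weight_relation:
  assumes "j + b = 1 + lam + e" "(sig - 1) + lam * (n - 1) = b + m 1" "2 \<le> sig" "sig \<le> n"
  shows "(j * h) * m 1 + b * m 2 = m sig + lam * m n"
proof -
  have "m sig + lam * m n = h * ((1 + lam) * m 1 + ((sig - 1) + lam * (n - 1)) * e)"
    using assms(3,4) by (rule weight_pair)
  also have "\<dots> = h * ((1 + lam + e) * m 1 + b * e)"
    unfolding assms(2) by (simp add: algebra_simps)
  also have "\<dots> = (j * h) * m 1 + b * m 2"
    unfolding assms(1)[symmetric] using m_eq[of 2] n by (simp add: algebra_simps)
  finally show ?thesis by simp
qed

text \<open>For \<open>1 \<le> j < \<delta>/h\<close>, \<open>\<beta>\<^sub>j\<close> is the ceiling of \<open>(m\<^sub>1 + (d/h - j)(n - 1)) / (n - 2)\<close>.\<close>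

lemma beta_candidate:
  assumes j: "1 \<le> j" "j \<le> p + e"
  obtains b sig lam :: nat where "1 \<le> b" "3 \<le> sig" "sig \<le> n" "j + b = 1 + lam + e"
    "(sig - 1) + lam * (n - 1) = b + m 1"
    "(int (n - 1) - 1) * (int b - 1) < int (m 1) + int e * int (n - 1) - int j * int (n - 1)"
proof -
  define N where "N = int (n - 1)"
  \<comment> \<open>\<open>x\<close> is the left-hand side of \<open>tail_semigroup_bound\<close>,
    \<open>b\<close> the ceiling of x/(N-1) and \<open>r\<close> the rounding excess. Then b + m_1 +
    r = (b+j-e)N: the b+j-e tail factors are all x_n, except that the excess lowers one of them to
    x_{n-r}. This gives \<open>sig\<close> and \<open>lam\<close>, and r <= N-2 keeps
    \<open>sig\<close> at 3 or more.\<close>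
  define x where "x = int (m 1) + int e * N - int j * N"
  define b where "b = (x + N - 2) div (N - 1)"
  define r where "r = (N - 1) * b - x"
  have N: "N \<ge> 2" using n by (simp add: N_def)
  have "int j * N \<le> (int p + int e) * N"
    using j N by (intro mult_right_mono) auto
  moreover have "int (m 1) = int p * N + int s"
    using p_s by (simp add: N_def)
  \<comment> \<open>Here j <= p+e enters: x is at least s.\<close>
  ultimately have x: "x \<ge> 1"
    using p_s unfolding x_def by (auto simp: algebra_simps)
  have "(N - 1) * b + (x + N - 2) mod (N - 1) = x + N - 2"
    unfolding b_def by simp
  moreover have "0 \<le> (x + N - 2) mod (N - 1)" "(x + N - 2) mod (N - 1) < N - 1"
    using N by simp_all
  ultimately have r: "0 \<le> r" "r \<le> N - 2"
    unfolding r_def by linarith+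
  have "0 < (N - 1) * b"
    using r x by (simp add: r_def)
  then have b: "b \<ge> 1"
    using N by (simp add: zero_less_mult_iff)
  have eq: "b + int (m 1) + r = (b + int j - int e) * N"
    unfolding r_def x_def by (simp add: algebra_simps)
  then have "0 < (b + int j - int e) * N"
    using b r by linarith
  then have pos: "b + int j - int e \<ge> 1"
    using N by (simp add: zero_less_mult_iff)
  define sig where "sig = nat (int n - r)"
  define lam where "lam = nat (b + int j - int e - 1)"
  have sig: "int sig = int n - r" and lam: "int lam = b + int j - int e - 1"
    using r pos n by (simp_all add: sig_def lam_def N_def)
  show ?thesis
  proof
    show "1 \<le> nat b" "3 \<le> sig" "sig \<le> n"
      using b r sig n by (auto simp: N_def)
    show "j + nat b = 1 + lam + e"
      using lam b by linarith
    have "int (sig - 1) = N - r"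
      using sig r n by (simp add: N_def of_nat_diff)
    moreover have "int lam * N = (b + int j - int e) * N - N"
      by (simp add: lam algebra_simps)
    ultimately have "int (sig - 1) + int lam * N = b + int (m 1)"
      using eq by linarith
    then have "int ((sig - 1) + lam * (n - 1)) = int (nat b + m 1)"
      using b by (simp add: N_def)
    then show "(sig - 1) + lam * (n - 1) = nat b + m 1"
      by (simp only: of_nat_eq_iff)
    show "(int (n - 1) - 1) * (int (nat b) - 1) < int (m 1) + int e * int (n - 1) - int j * int (n - 1)"
      using b r unfolding r_def x_def N_def[symmetric] by (simp add: algebra_simps)
  qed
qed

text \<open>After this lemma the original definitions of the three integers are hardly needed. The
  exceptional index j = delta/h = p+e+1 obeys the same relations because m_1 = p(n-1)+s. It is the
  reason for the weaker range 2 <= sigma_j, as s+1 may be 2, and for separating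
  \<open>beta_lt\<close> from the sharper \<open>beta_ceiling\<close>.\<close>

lemma binomial_data:
  assumes j: "1 \<le> j" "j \<le> p + e + 1"
  defines "b \<equiv> beta n m h d p j" and "sig \<equiv> sigma n m h d p s j" and "lam \<equiv> lambda n m h d p s j"
  shows sigma_range: "2 \<le> sig" "sig \<le> n"
    and degree_relation: "j + b = 1 + lam + e"
    and tail_relation: "(sig - 1) + lam * (n - 1) = b + m 1"
    and beta_lt: "(int (n - 1) - 1) * int b
      < int (m 1) + int e * int (n - 1) - int j * int (n - 1) + int (n - 1)"
    and beta_pos: "j \<le> p + e \<Longrightarrow> 1 \<le> b"
    and beta_ceiling: "j \<le> p + e \<Longrightarrow>
      (int (n - 1) - 1) * (int b - 1) < int (m 1) + int e * int (n - 1) - int j * int (n - 1)"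
    and beta_last: "j = p + e + 1 \<Longrightarrow> b = 0"
proof -
  have "2 \<le> sig \<and> sig \<le> n \<and> j + b = 1 + lam + e \<and> (sig - 1) + lam * (n - 1) = b + m 1 \<and>
    (int (n - 1) - 1) * int b < int (m 1) + int e * int (n - 1) - int j * int (n - 1) + int (n - 1) \<and>
    (j \<le> p + e \<longrightarrow> 1 \<le> b \<and>
      (int (n - 1) - 1) * (int b - 1) < int (m 1) + int e * int (n - 1) - int j * int (n - 1)) \<and>
    (j = p + e + 1 \<longrightarrow> b = 0)"
  proof (cases "j = p + e + 1")
    case True
    then have "b = 0" "sig = s + 1" "lam = p"
      by (simp_all add: b_def sig_def lam_def beta_def sigma_def lambda_def sigma_lambda_def delta_div)
    moreover have "int (m 1) = int p * int (n - 1) + int s"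
      using p_s by simp
    ultimately show ?thesis
      using True p_s n by (auto simp: algebra_simps)
  next
    case False
    then have j': "1 \<le> j" "j \<le> p + e" using j by auto
    obtain b' sig' lam' :: nat where c: "1 \<le> b'" "3 \<le> sig'" "sig' \<le> n" "j + b' = 1 + lam' + e"
      "(sig' - 1) + lam' * (n - 1) = b' + m 1"
      "(int (n - 1) - 1) * (int b' - 1) < int (m 1) + int e * int (n - 1) - int j * int (n - 1)"
      using beta_candidate[OF j'] by metis
    have rel: "(j * h) * m 1 + b' * m 2 = m sig' + lam' * m n"
      using c by (intro weight_relation) auto
    have tail: "m sg + lm * m n \<in> tail_semigroup n m" if "3 \<le> sg" "sg \<le> n" for sg lm
    proof -
      have "(\<Sum>i=3..n. ((if i = sg then 1 else 0) + (if i = n then lm else 0)) * m i) = m sg + lm * m n"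
        using that n by (simp add: distrib_right sum.distrib if_distrib[of "\<lambda>x. x * _"] sum.delta cong: if_cong)
      then show ?thesis
        unfolding tail_semigroup_def
        by (intro CollectI exI[of _ "\<lambda>i. (if i = sg then 1 else 0) + (if i = n then lm else 0)"]) simp
    qed
    have b: "b = b'"
      unfolding b_def beta_def using False
    proof (simp add: delta_div, intro Least_equality)
      show "0 < b' \<and> j * h * m (Suc 0) + b' * m 2 \<in> tail_semigroup n m"
        using c rel tail[of sig' lam'] by simp
    next
      fix y assume y: "0 < y \<and> j * h * m (Suc 0) + y * m 2 \<in> tail_semigroup n m"
      then have "(int (n - 1) - 1) * (int b' - 1) < (int (n - 1) - 1) * int y"
        using tail_semigroup_bound[of j y] j' c(6) by simp
      then show "b' \<le> y"
        using n by (simp add: mult_less_cancel_left)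
    qed
    have "(THE (sg, lm). sg \<in> {3..n} \<and> (j * h) * m 1 + beta n m h d p j * m 2 = m sg + lm * m n) = (sig', lam')"
    proof (rule the_equality)
      show "case (sig', lam') of (sg, lm) \<Rightarrow> sg \<in> {3..n} \<and>
          (j * h) * m 1 + beta n m h d p j * m 2 = m sg + lm * m n"
        using c rel b by (simp add: b_def)
    next
      fix z
      assume "case z of (sg, lm) \<Rightarrow> sg \<in> {3..n} \<and>
          (j * h) * m 1 + beta n m h d p j * m 2 = m sg + lm * m n"
      then obtain sg lm where z: "z = (sg, lm)" "3 \<le> sg" "sg \<le> n"
        "m sig' + lam' * m n = m sg + lm * m n"
        using rel b by (auto simp: b_def)
      have "0 * m 1 + h * ((1 + lam') * m 1 + ((sig' - 1) + lam' * (n - 1)) * e)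
          = 0 * m 1 + h * ((1 + lm) * m 1 + ((sg - 1) + lm * (n - 1)) * e)"
        using z(4) weight_pair[of sig' lam'] weight_pair[of sg lm] z(2,3) c(2,3) by simp
      then obtain k l where kl: "int 0 = int 0 + l * int h"
        "int ((sg - 1) + lm * (n - 1)) = int ((sig' - 1) + lam' * (n - 1)) + k * int (m 1)"
        "int (1 + lm) = int (1 + lam') - l - k * int e"
        by (rule weight_params)
      have "l = 0" using kl(1) h by simp
      \<comment> \<open>With fewer copies of x_n one gets k > 0, so the total tail weight cannot
        drop; but at least n-1 is lost there, while \<open>sg\<close> exceeds \<open>sig'\<close> by
        at most n-3. The other case is symmetric.\<close>
      have "lm = lam'"
      proof (rule linorder_cases[of lm lam'])
        have Tsg: "sg - 1 \<le> n - 1" "2 \<le> sg - 1" "sig' - 1 \<le> n - 1" "2 \<le> sig' - 1"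
          using z c by auto
        { assume lt: "lm < lam'"
          then have "0 < k * int e" using kl(3) \<open>l = 0\<close> by simp
          then have "k > 0" using e_pos by (simp add: zero_less_mult_iff)
          then have "0 \<le> k * int (m 1)" by simp
          with kl(2) have "sig' - 1 + lam' * (n - 1) < sg - 1 + lm * (n - 1) + 1"
            by linarith
          moreover have "(lm + 1) * (n - 1) \<le> lam' * (n - 1)"
            using lt by (intro mult_right_mono) auto
          ultimately show ?thesis
            using Tsg unfolding distrib_right mult_1 by linarith }
        { assume lt: "lam' < lm"
          then have "k * int e < 0" using kl(3) \<open>l = 0\<close> by simp
          then have "k < 0" using e_pos by (simp add: mult_less_0_iff)
          then have "k * int (m 1) \<le> 0" by (simp add: mult_nonpos_nonneg)
          with kl(2) have "sg - 1 + lm * (n - 1) < sig' - 1 + lam' * (n - 1) + 1"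
            by linarith
          moreover have "(lam' + 1) * (n - 1) \<le> lm * (n - 1)"
            using lt by (intro mult_right_mono) auto
          ultimately show ?thesis
            using Tsg unfolding distrib_right mult_1 by linarith }
      qed
      then have "k * int e = 0" using kl(3) \<open>l = 0\<close> by simp
      then have "k = 0" using e_pos by simp
      with kl(2) \<open>lm = lam'\<close> have "sg = sig'"
        using z c by auto
      with \<open>lm = lam'\<close> z show "z = (sig', lam')" by simp
    qed
    then have "sig = sig'" "lam = lam'"
      using False by (simp_all add: sig_def lam_def sigma_def lambda_def sigma_lambda_def delta_div)
    moreover have "(int (n - 1) - 1) * int b' < int (m 1) + int e * int (n - 1) - int j * int (n - 1) + int (n - 1)"
      using c(6) by (simp add: algebra_simps)
    ultimately show ?thesis
      using c b False by simp
  qed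
  then show "2 \<le> sig" "sig \<le> n" "j + b = 1 + lam + e" "(sig - 1) + lam * (n - 1) = b + m 1"
    "(int (n - 1) - 1) * int b < int (m 1) + int e * int (n - 1) - int j * int (n - 1) + int (n - 1)"
    "j \<le> p + e \<Longrightarrow> 1 \<le> b"
    "j \<le> p + e \<Longrightarrow>
      (int (n - 1) - 1) * (int b - 1) < int (m 1) + int e * int (n - 1) - int j * int (n - 1)"
    "j = p + e + 1 \<Longrightarrow> b = 0"
    by blast+
qed


section \<open>The new leading monomials\<close>

definition new_lead1 :: "nat \<Rightarrow> nat monom" where
  "new_lead1 i = single 1 h + single i 1"

definition new_trail1 :: "nat \<Rightarrow> nat monom" where
  "new_trail1 i = single 2 1 + single (i - 1) 1 + single (n + 1) (h - 1)"

definition new_lead2 :: "nat \<Rightarrow> nat monom" where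
  "new_lead2 j = single 1 (j * h) + single 2 (beta n m h d p j)"

definition new_trail2 :: "nat \<Rightarrow> nat monom" where
  "new_trail2 j = single (sigma n m h d p s j) 1 + single n (lambda n m h d p s j)
    + single (n + 1) (j * (h - 1) + e)"

definition new_leads :: "nat monom set" where
  "new_leads = new_lead1 ` {3..n} \<union> new_lead2 ` {1..p + e + 1}"

lemma lookup_sum_single:
  "lookup (single i k + single j l) x = (if i = x then k else 0) + (if j = x then l else (0 :: nat))"
  by (simp add: lookup_add lookup_single when_def)

text \<open>The shift is l = -1, k = 0: x_1^h is traded for one more tail factor at the same tail
  weight. The trailing monomial is smaller because h > 1 puts x_{n+1} into it alone.\<close>

lemma new1:
  assumes "3 \<le> i" "i \<le> n"
  shows "keys (new_lead1 i) \<subseteq> {1..n+1}" "keys (new_trail1 i) \<subseteq> {1..n+1}"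
    "fib (new_lead1 i) (new_trail1 i)" "drl_less (new_trail1 i) (new_lead1 i)"
proof -
  show k1: "keys (new_lead1 i) \<subseteq> {1..n+1}" and k2: "keys (new_trail1 i) \<subseteq> {1..n+1}"
    using assms h n by (auto simp: new_lead1_def new_trail1_def keys_add_nat)
  have l: "lookup (new_lead1 i) 1 = h" "lookup (new_lead1 i) (n + 1) = 0"
    "lookup (new_trail1 i) 1 = 0" "lookup (new_trail1 i) (n + 1) = h - 1"
    using assms n by (auto simp: new_lead1_def new_trail1_def lookup_add lookup_single when_def)
  have c: "tail_count (new_lead1 i) = 1" "tail_weight (new_lead1 i) = i - 1"
    "tail_count (new_trail1 i) = 2" "tail_weight (new_trail1 i) = i - 1"
    using assms n by (auto simp: new_lead1_def new_trail1_def tail_count_add tail_weight_add tail_single)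
  show f: "fib (new_lead1 i) (new_trail1 i)"
  proof (rule fiberI[OF k1 k2, of "-1" 0])
    show "int (lookup (new_trail1 i) 1) = int (lookup (new_lead1 i) 1) + - 1 * int h"
      unfolding l by simp
    show "lookup (new_lead1 i) 1 + tail_count (new_lead1 i) + lookup (new_lead1 i) (n + 1)
      = lookup (new_trail1 i) 1 + tail_count (new_trail1 i) + lookup (new_trail1 i) (n + 1)"
      unfolding l c using h by simp
  qed (simp_all add: c)
  show "drl_less (new_trail1 i) (new_lead1 i)"
  proof (rule drl_lessI_top[of _ _ "n + 1"])
    show "monom_degree (new_trail1 i) = monom_degree (new_lead1 i)"
      using f by (simp add: same_fiber_def)
    show "lookup (new_lead1 i) (n + 1) < lookup (new_trail1 i) (n + 1)"
      unfolding l using h by simp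
    show "lookup (new_trail1 i) j = lookup (new_lead1 i) j" if "j > n + 1" for j
      using that assms by (auto simp: new_lead1_def new_trail1_def lookup_add lookup_single when_def)
  qed
qed

text \<open>The shift is l = -j, k = 1, and again only the trailing monomial contains
  x_{n+1}.\<close>

lemma new2:
  assumes j: "1 \<le> j" "j \<le> p + e + 1"
  shows "keys (new_lead2 j) \<subseteq> {1..n+1}" "keys (new_trail2 j) \<subseteq> {1..n+1}"
    "fib (new_lead2 j) (new_trail2 j)" "drl_less (new_trail2 j) (new_lead2 j)"
proof -
  define b sig lam where "b = beta n m h d p j" and "sig = sigma n m h d p s j"
    and "lam = lambda n m h d p s j"
  note data = binomial_data[OF j, folded b_def sig_def lam_def]
  have lead: "new_lead2 j = single 1 (j * h) + single 2 b"
    and trail: "new_trail2 j = single sig 1 + single n lam + single (n + 1) (j * (h - 1) + e)"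
    by (simp_all add: new_lead2_def new_trail2_def b_def sig_def lam_def)
  show k1: "keys (new_lead2 j) \<subseteq> {1..n+1}" and k2: "keys (new_trail2 j) \<subseteq> {1..n+1}"
    unfolding lead trail keys_add_nat using data(1,2) n by auto
  have l: "lookup (new_lead2 j) 1 = j * h" "lookup (new_lead2 j) (n + 1) = 0"
    "lookup (new_trail2 j) 1 = 0" "lookup (new_trail2 j) (n + 1) = j * (h - 1) + e"
    unfolding lead trail using data(1,2) n by (auto simp: lookup_add lookup_single when_def)
  have c: "tail_count (new_lead2 j) = b" "tail_weight (new_lead2 j) = b"
    "tail_count (new_trail2 j) = 1 + lam" "tail_weight (new_trail2 j) = (sig - 1) + lam * (n - 1)"
    unfolding lead trail using data(1,2) n by (auto simp: tail_count_add tail_weight_add tail_single)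
  have jh: "j * h = j + j * (h - 1)"
    using h by (cases h) auto
  show f: "fib (new_lead2 j) (new_trail2 j)"
  proof (rule fiberI[OF k1 k2, of "- int j" 1])
    show "int (lookup (new_trail2 j) 1) = int (lookup (new_lead2 j) 1) + - int j * int h"
      unfolding l by simp
    show "int (tail_weight (new_trail2 j)) = int (tail_weight (new_lead2 j)) + 1 * int (m 1)"
      unfolding c data(4) by simp
    show "int (tail_count (new_trail2 j)) = int (tail_count (new_lead2 j)) - - int j - 1 * int e"
      unfolding c using data(3) by simp
    show "lookup (new_lead2 j) 1 + tail_count (new_lead2 j) + lookup (new_lead2 j) (n + 1)
      = lookup (new_trail2 j) 1 + tail_count (new_trail2 j) + lookup (new_trail2 j) (n + 1)"
      unfolding l c jh using data(3) by simp
  qed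
  show "drl_less (new_trail2 j) (new_lead2 j)"
  proof (rule drl_lessI_top[of _ _ "n + 1"])
    show "monom_degree (new_trail2 j) = monom_degree (new_lead2 j)"
      using f by (simp add: same_fiber_def)
    show "lookup (new_lead2 j) (n + 1) < lookup (new_trail2 j) (n + 1)"
      unfolding l using e_pos by simp
    show "lookup (new_trail2 j) i = lookup (new_lead2 j) i" if "i > n + 1" for i
      unfolding lead trail using that data(1,2) n by (auto simp: lookup_add lookup_single when_def)
  qed
qed

lemma new_leads_reducible:
  assumes "w \<in> new_leads"
  obtains u where "keys w \<subseteq> {1..n+1}" "keys u \<subseteq> {1..n+1}" "fib w u" "drl_less u w"
proof -
  from assms consider (1) i where "w = new_lead1 i" "3 \<le> i" "i \<le> n"
    | (2) j where "w = new_lead2 j" "1 \<le> j" "j \<le> p + e + 1"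
    unfolding new_leads_def by auto
  then show ?thesis
  proof cases
    case 1
    show ?thesis using that new1[OF 1(2,3)] unfolding 1(1) .
  next
    case 2
    show ?thesis using that new2[OF 2(2,3)] unfolding 2(1) .
  qed
qed

lemma new_leads_x1: "w \<in> new_leads \<Longrightarrow> lookup w 1 > 0"
  unfolding new_leads_def new_lead1_def new_lead2_def using h
  by (auto simp: lookup_add lookup_single when_def)

lemma tail_only_x2:
  assumes "\<And>i. 3 \<le> i \<Longrightarrow> i \<le> n \<Longrightarrow> lookup t i = 0"
  shows "tail_count t = lookup t 2" "tail_weight t = lookup t 2"
proof -
  have "2 \<le> i \<and> i \<le> n \<longleftrightarrow> i = 2" if "i \<in> keys t" for i
  proof (cases "3 \<le> i \<and> i \<le> n")
    case True
    with assms[of i] that show ?thesis by (simp add: in_keys_iff)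
  next
    case False
    with n show ?thesis by auto
  qed
  then show "tail_count t = lookup t 2" "tail_weight t = lookup t 2"
    unfolding tail_count_def tail_weight_def lookup_conv_wdeg by (auto intro!: wdeg_cong)
qed

text \<open>Let the exponents of x_1 differ by jh. If some x_i with i >= 3 divides \<open>z\<close>,
  then x_1^h x_i does. Otherwise the tail of \<open>z\<close> is a power of x_2, and
  \<open>arithmetic_fiber_bound\<close> with the ceiling property makes its exponent at least
  beta_j. Once j exceeds p+e, the pure power with beta = 0 divides.\<close>

lemma new_lead_divides:
  assumes "keys z \<subseteq> {1..n+1}" "keys z' \<subseteq> {1..n+1}" "fib z z'" "lookup z' 1 < lookup z 1"
  shows "\<exists>w\<in>new_leads. monom_dvd w z"
proof -
  obtain k l where kl: "int (lookup z' 1) = int (lookup z 1) + l * int h"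
    "int (tail_weight z') = int (tail_weight z) + k * int (m 1)"
    "int (tail_count z') = int (tail_count z) - l - k * int e"
    "lookup z 1 + tail_count z + lookup z (n + 1) = lookup z' 1 + tail_count z' + lookup z' (n + 1)"
    using fiber_params[OF assms(1-3)] .
  have "l * int h < 0"
    using kl(1) assms(4) by simp
  then have "l < 0"
    by (simp add: mult_less_0_iff)
  define j where "j = nat (- l)"
  have j: "1 \<le> j" "l = - int j"
    using \<open>l < 0\<close> by (simp_all add: j_def)
  have "int (lookup z 1) = int (lookup z' 1 + j * h)"
    using kl(1) j by simp
  then have x1: "lookup z 1 = lookup z' 1 + j * h"
    by (simp only: of_nat_eq_iff)
  show ?thesis
  proof (cases "\<exists>i. 3 \<le> i \<and> i \<le> n \<and> lookup z i > 0")
    case True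
    then obtain i where i: "3 \<le> i" "i \<le> n" "lookup z i > 0" by blast
    have "h \<le> j * h"
      using j by simp
    then have "h \<le> lookup z 1"
      using x1 by linarith
    then have "monom_dvd (new_lead1 i) z"
      using i unfolding monom_dvd_iff new_lead1_def by (auto simp: lookup_sum_single)
    with i show ?thesis by (auto simp: new_leads_def)
  next
    case False
    then have b: "tail_count z = lookup z 2" "tail_weight z = lookup z 2"
      by (auto intro: tail_only_x2)
    show ?thesis
    proof (cases "j \<le> p + e")
      case False
      have "(p + e + 1) * h \<le> j * h"
        using False by (intro mult_right_mono) auto
      then have "(p + e + 1) * h \<le> lookup z 1"
        using x1 by simp
      moreover have "beta n m h d p (p + e + 1) = 0"
        by (simp add: beta_def delta_div)
      ultimately have "monom_dvd (new_lead2 (p + e + 1)) z"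
        unfolding monom_dvd_iff new_lead2_def lookup_sum_single by auto
      then show ?thesis by (auto simp: new_leads_def)
    next
      case True
      have "int (tail_weight z') \<le> int (tail_count z') * int (n - 1)"
        using tail_bounds(2)[of z'] by (metis of_nat_le_iff of_nat_mult)
      then have "int (m 1) + int e * int (n - 1) - int j * int (n - 1) \<le> (int (n - 1) - 1) * int (lookup z 2)"
        using kl(2,3) b j m1_pos e_pos n tail_bounds(1)[of z']
        by (intro arithmetic_fiber_bound(2)[where k = k and R = "int (tail_count z')" and T = "int (tail_weight z')"]) auto
      then have "(int (n - 1) - 1) * (int (beta n m h d p j) - 1) < (int (n - 1) - 1) * int (lookup z 2)"
        using beta_ceiling[of j] j True by linarith
      then have "beta n m h d p j \<le> lookup z 2"
        using n by (simp add: mult_less_cancel_left)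
      then have "monom_dvd (new_lead2 j) z"
        using x1 unfolding monom_dvd_iff new_lead2_def by (auto simp: lookup_sum_single)
      with j True show ?thesis by (auto simp: new_leads_def)
    qed
  qed
qed

section \<open>Connected components of fibers\<close>

lemma fiber_degree_1:
  assumes "keys t \<subseteq> {1..n+1}" "keys u \<subseteq> {1..n+1}" "monom_degree t = 1" "fib t u"
  shows "t = u"
proof -
  have "monom_degree u = 1"
    using assms by (simp add: same_fiber_def)
  then obtain i j where ij: "t = single i 1" "u = single j 1"
    using assms(3) monom_degree_eq_1 by metis
  then have "i \<in> {1..n+1}" "j \<in> {1..n+1}"
    using assms by auto
  moreover have "(if i = n + 1 then 0 else m i) = (if j = n + 1 then 0 else m j)"
    using assms(4) unfolding same_fiber_def weight_def ij by simp
  ultimately show ?thesis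
    using weight_inj ij by (auto dest: inj_onD)
qed

text \<open>Equality in \<open>tail_bounds\<close> forces every tail factor to have step count 1,
  that is, to be x_2.\<close>

lemma tail_count_eq_weight:
  assumes "keys t \<subseteq> {1..n+1}" "lookup t 1 = 0" "lookup t (n + 1) = 0" "tail_count t = tail_weight t"
  shows "t = single 2 (tail_count t)"
proof -
  have "i = 2" if "i \<in> keys t" for i
  proof -
    from that obtain u where u: "t = single i 1 + u"
      using split_variable[of 1 t i] by (auto simp: in_keys_iff)
    have "i \<noteq> 1" "i \<noteq> n + 1"
      using that assms(2,3) by (auto simp: in_keys_iff)
    with that assms(1) have i: "2 \<le> i" "i \<le> n"
      by force+
    with assms(4) tail_bounds(1)[of u] have "i - 1 \<le> 1"
      by (simp add: u tail_count_add tail_weight_add tail_single)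
    with i show ?thesis by simp
  qed
  then have l: "lookup t i = 0" if "i \<noteq> 2" for i
    using that by (auto simp: in_keys_iff)
  have "tail_count t = lookup t 2"
    using l by (intro tail_only_x2(1)) auto
  with l show ?thesis
    by (intro poly_mapping_eqI) (auto simp: lookup_single when_def)
qed

text \<open>The exponent of x_1 in \<open>z\<close> is a multiple of h. If it is positive, x_1^h
  cancels and degree 1 remains. If it is 0, the shared variable is x_i; cancelling it leaves R = 1 -
  ke and T = k m_1, which violates R <= T <= R(n-1) for every k.\<close>

lemma new_lead1_isolated:
  assumes i: "3 \<le> i" "i \<le> n" and z: "keys z \<subseteq> {1..n+1}" "fib (new_lead1 i) z"
    and share: "lookup (new_lead1 i) x > 0" "lookup z x > 0"
  shows "z = new_lead1 i"
proof -
  have x1_dvd: "z = new_lead1 i" if "h \<le> lookup z 1"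
  proof -
    from that obtain u where u: "z = single 1 h + u" by (rule split_variable)
    then have "fib (single i 1) u"
      using z(2) by (simp add: new_lead1_def same_fiber_add_iff)
    moreover have "keys u \<subseteq> {1..n+1}"
      using z(1) by (simp add: u keys_add_nat)
    ultimately have "single i 1 = u"
      using i by (intro fiber_degree_1) auto
    with u show ?thesis by (simp add: new_lead1_def)
  qed
  obtain k l where kl: "int (lookup z 1) = int (lookup (new_lead1 i) 1) + l * int h"
    "int (tail_weight z) = int (tail_weight (new_lead1 i)) + k * int (m 1)"
    "int (tail_count z) = int (tail_count (new_lead1 i)) - l - k * int e"
    using fiber_params[OF new1(1)[OF i] z] by metis
  have lead: "lookup (new_lead1 i) 1 = h" "tail_weight (new_lead1 i) = i - 1" "tail_count (new_lead1 i) = 1"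
    using i n by (auto simp: new_lead1_def lookup_sum_single tail_count_add tail_weight_add tail_single)
  have c: "int (lookup z 1) = (1 + l) * int h"
    using kl(1) lead by (simp add: algebra_simps)
  show ?thesis
  proof (cases "lookup z 1 = 0")
    case False
    then have "0 < (1 + l) * int h"
      using c by linarith
    then have "0 < 1 + l"
      using h by (simp add: zero_less_mult_iff)
    then have "1 * int h \<le> (1 + l) * int h"
      by (intro mult_right_mono) auto
    then have "h \<le> lookup z 1"
      using c by linarith
    then show ?thesis by (rule x1_dvd)
  next
    case True
    then have l: "l = - 1"
      using c h by simp
    from True share i have "x = i"
      by (auto simp: new_lead1_def lookup_sum_single split: if_splits)
    with share obtain u where u: "z = single i 1 + u"
      using split_variable[of 1 z i] by auto
    have "int (tail_weight u) = k * int (m 1)" "int (tail_count u) = 1 - k * int e"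
      using kl(2,3) i n by (simp_all add: u lead l tail_count_add tail_weight_add tail_single)
    moreover have "int (tail_weight u) \<le> int (tail_count u) * int (n - 1)"
      using tail_bounds(2)[of u] by (metis of_nat_le_iff of_nat_mult)
    moreover have "tail_count u \<le> tail_weight u"
      by (rule tail_bounds)
    ultimately have False
    proof (cases "k \<ge> 1")
      case True
      then have "1 * 1 \<le> k * int e"
        using e_pos by (intro mult_mono) auto
      with \<open>int (tail_count u) = 1 - k * int e\<close> have "tail_count u = 0" by linarith
      with \<open>int (tail_weight u) \<le> int (tail_count u) * int (n - 1)\<close> have "tail_weight u = 0" by simp
      with \<open>int (tail_weight u) = k * int (m 1)\<close> True m1_pos show False by simp
    next
      case False
      then have "k * int (m 1) \<le> 0" "k * int e \<le> 0"
        by (simp_all add: mult_nonpos_nonneg)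
      with \<open>int (tail_weight u) = k * int (m 1)\<close> \<open>int (tail_count u) = 1 - k * int e\<close>
        \<open>tail_count u \<le> tail_weight u\<close> show False by linarith
    qed
    then show ?thesis ..
  qed
qed

text \<open>With x_1 in \<open>z\<close>, one has l > -j. The inequality \<open>beta_lt\<close>
  excludes k >= 1 for l >= 0, and for l < 0 it excludes giving up fewer than j factors x_1^h. What
  remains, l = k = 0, is the monomial itself. Without x_1 the shared variable is x_2, and cancelling
  it would let beta_j - 1 satisfy the bound that beta_j is the first to satisfy.\<close>

lemma new_lead2_isolated:
  assumes j: "1 \<le> j" "j \<le> p + e + 1" and z: "keys z \<subseteq> {1..n+1}" "fib (new_lead2 j) z"
    and share: "lookup (new_lead2 j) x > 0" "lookup z x > 0"
  shows "z = new_lead2 j"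
proof -
  define b N where "b = beta n m h d p j" and "N = int (n - 1)"
  note data = binomial_data[OF j, folded b_def N_def]
  have N: "N \<ge> 2" using n by (simp add: N_def)
  have wdef: "new_lead2 j = single 1 (j * h) + single 2 b"
    by (simp add: new_lead2_def b_def)
  have lead: "lookup (new_lead2 j) 1 = j * h" "tail_weight (new_lead2 j) = b"
    "tail_count (new_lead2 j) = b" "lookup (new_lead2 j) (n + 1) = 0"
    using n by (auto simp: wdef lookup_sum_single tail_count_add tail_weight_add tail_single)
  obtain k l where kl: "int (lookup z 1) = int (j * h) + l * int h"
    "int (tail_weight z) = int b + k * int (m 1)"
    "int (tail_count z) = int b - l - k * int e"
    "j * h + b = lookup z 1 + tail_count z + lookup z (n + 1)"
    using fiber_params[OF new2(1)[OF j] z] unfolding lead by (metis add_0_right)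
  have upper: "int (tail_weight z) \<le> int (tail_count z) * N"
    using tail_bounds(2)[of z] unfolding N_def by (metis of_nat_le_iff of_nat_mult)
  have lower: "int (tail_count z) \<le> int (tail_weight z)"
    using tail_bounds(1) by simp
  have c: "int (lookup z 1) = (int j + l) * int h"
    using kl(1) by (simp add: algebra_simps)
  have "int (j * h + b) = int (lookup z 1 + tail_count z + lookup z (n + 1))"
    using kl(4) by simp
  then have ke: "k * int e = l * (int h - 1) + int (lookup z (n + 1))"
    using kl(1,3) by (simp add: algebra_simps)
  have jN: "int j * N \<ge> N"
    using j N by (simp add: mult_le_cancel_right1)
  \<comment> \<open>Such a shift would need m_1 + eN <= (N-1)b, contrary to \<open>beta_lt\<close>
    because jN >= N.\<close>
  have no_k: False if "k \<ge> 1" "l \<ge> 0"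
  proof -
    have "1 * (int (m 1) + int e * N) \<le> k * (int (m 1) + int e * N)"
      using that N by (intro mult_right_mono) auto
    moreover have "l * N \<ge> 0" using that N by simp
    moreover have "int b + k * int (m 1) \<le> (int b - l - k * int e) * N"
      using upper kl by simp
    ultimately have "int (m 1) + int e * N \<le> (N - 1) * int b"
      by (simp add: algebra_simps)
    with data(5) jN show False by simp
  qed
  show ?thesis
  proof (cases "lookup z 1 = 0")
    case False
    then have "0 < (int j + l) * int h"
      using c by linarith
    then have pos: "0 < int j + l"
      using h by (simp add: zero_less_mult_iff)
    consider "l \<ge> 1" | "l = 0" | "l \<le> - 1" by linarith
    then show ?thesis
    proof cases
      case 1
      have "1 * 1 \<le> l * (int h - 1)"
        using 1 h by (intro mult_mono) auto
      then have "0 < k * int e" using ke by linarith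
      then have "k \<ge> 1" using e_pos by (simp add: zero_less_mult_iff)
      with no_k 1 show ?thesis by simp
    next
      case 2
      have "k * int e \<ge> 0"
        using ke 2 by simp
      then have "k \<ge> 0"
        using e_pos by (simp add: zero_le_mult_iff)
      with no_k 2 have k: "k = 0" by force
      have "int (lookup z 1) = int (j * h)"
        using kl(1) 2 by simp
      then have "j * h \<le> lookup z 1"
        by (simp only: of_nat_eq_iff)
      then obtain u where u: "z = single 1 (j * h) + u" by (rule split_variable)
      have "lookup u 1 = 0" "lookup u (n + 1) = 0" "tail_count u = b" "tail_weight u = b"
        using kl 2 k ke n by (auto simp: u lookup_add lookup_single when_def tail_count_add
            tail_weight_add tail_single)
      moreover have "keys u \<subseteq> {1..n+1}"
        using z(1) by (simp add: u keys_add_nat)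
      ultimately have "u = single 2 b"
        using tail_count_eq_weight[of u] by simp
      with u show ?thesis by (simp add: wdef)
    next
      case 3
      have "int (m 1) + int e * N - (- l) * N \<le> (N - 1) * int b"
        using 3 kl(2,3) lower upper m1_pos e_pos N
        by (intro arithmetic_fiber_bound(2)[where k = k and R = "int (tail_count z)" and T = "int (tail_weight z)"]) auto
      then have "(int j - 1) * N < (- l) * N"
        using data(5) by (simp add: algebra_simps)
      then have "int j - 1 < - l"
        by (rule mult_right_less_imp_less) (use N in simp)
      with pos show ?thesis by simp
    qed
  next
    case True
    then have l: "l = - int j"
      using c h by simp
    have "x = 2" "b \<ge> 1"
      using True share by (auto simp: wdef lookup_sum_single split: if_splits)
    with share obtain u where u: "z = single 2 1 + u"
      using split_variable[of 1 z 2] by auto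
    have uc: "tail_count z = tail_count u + 1" "tail_weight z = tail_weight u + 1"
      using n by (simp_all add: u tail_count_add tail_weight_add tail_single)
    have "int (tail_weight u) \<le> int (tail_count u) * N"
      using tail_bounds(2)[of u] unfolding N_def by (metis of_nat_le_iff of_nat_mult)
    then have "int (m 1) + int e * N - int j * N \<le> (N - 1) * (int b - 1)"
      using kl(2,3) uc l m1_pos e_pos N j tail_bounds(1)[of u]
      by (intro arithmetic_fiber_bound(2)[where k = k and R = "int (tail_count u)" and T = "int (tail_weight u)"]) auto
    moreover have "j \<le> p + e"
      using data(8) \<open>b \<ge> 1\<close> j by fastforce
    ultimately have False
      using data(7) by simp
    then show ?thesis ..
  qed
qed


text \<open>Within one fiber, \<open>S\<close> is closed under passing to monomials that share a
  variable, so it is a union of connected components; \<open>w\<close> is its least element. Closure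
  alone makes the coefficient sum over \<open>S\<close> vanish on mI, so connectedness is not
  demanded.\<close>

definition component :: "nat monom \<Rightarrow> nat monom set \<Rightarrow> bool" where
  "component w S \<longleftrightarrow> w \<in> S \<and>
    (\<forall>z\<in>S. keys z \<subseteq> {1..n+1} \<and> fib w z \<and> (z \<noteq> w \<longrightarrow> drl_less w z)) \<and>
    (\<forall>z\<in>S. \<forall>z'. keys z' \<subseteq> {1..n+1} \<longrightarrow> fib z z' \<longrightarrow>
      (\<exists>x. lookup z x > 0 \<and> lookup z' x > 0) \<longrightarrow> z' \<in> S)"

lemma new_lead_isolated:
  assumes "w \<in> new_leads" "keys z \<subseteq> {1..n+1}" "fib w z" "lookup w x > 0" "lookup z x > 0"
  shows "z = w"
proof -
  from assms(1) consider (1) i where "w = new_lead1 i" "3 \<le> i" "i \<le> n"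
    | (2) j where "w = new_lead2 j" "1 \<le> j" "j \<le> p + e + 1"
    unfolding new_leads_def by auto
  then show ?thesis
  proof cases
    case 1
    show ?thesis using new_lead1_isolated[OF 1(2,3)] assms(2-) unfolding 1(1) by blast
  next
    case 2
    show ?thesis using new_lead2_isolated[OF 2(2,3)] assms(2-) unfolding 2(1) by blast
  qed
qed

lemma new_lead_component:
  assumes "w \<in> new_leads"
  shows "component w {w}"
proof -
  have "keys w \<subseteq> {1..n+1}"
    using assms by (rule new_leads_reducible)
  moreover have "z' = w" if "keys z' \<subseteq> {1..n+1}" "fib w z'" "lookup w x > 0" "lookup z' x > 0" for z' x
    using new_lead_isolated[OF assms] that by blast
  ultimately show ?thesis
    unfolding component_def using same_fiber_refl by blast
qed

section \<open>Leading monomials of I(C') and their components\<close>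

text \<open>For \<open>t\<close> in the variables x_2, ..., x_{n+1} this is membership in the
  initial ideal of I(C'), stated without reference to any basis.\<close>

definition reducible2 :: "nat monom \<Rightarrow> bool" where
  "reducible2 t \<longleftrightarrow> (\<exists>u. keys u \<subseteq> {2..n+1} \<and> drl_less u t \<and> fib t u)"

lemma keys_2_subset: "keys t \<subseteq> {2..n+1} \<Longrightarrow> keys t \<subseteq> {1..n+1}"
  by auto

lemma keys_2_lookup: "keys t \<subseteq> {2..n+1} \<Longrightarrow> lookup t 1 = 0"
  by (auto simp: not_in_keys_iff_lookup_eq_zero subset_iff)

lemma lookup_above: "keys t \<subseteq> {1..n+1} \<Longrightarrow> j > n + 1 \<Longrightarrow> lookup t j = 0"
  by (auto simp: not_in_keys_iff_lookup_eq_zero subset_iff)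

text \<open>A common variable can be cancelled from \<open>t\<close> and its witness. Hence a
  minimal reducible monomial shares no variable with any smaller witness.\<close>

lemma reducible2_cancel:
  assumes "keys u \<subseteq> {2..n+1}" "drl_less u t" "fib t u" "lookup t x > 0" "lookup u x > 0"
  obtains v where "monom_dvd v t" "v \<noteq> t" "reducible2 v"
proof -
  from assms(4) obtain t' where t': "t = single x 1 + t'"
    using split_variable[of 1 t x] by auto
  from assms(5) obtain u' where u': "u = single x 1 + u'"
    using split_variable[of 1 u x] by auto
  have "keys u' \<subseteq> {2..n+1}"
    using assms(1) by (simp add: u' keys_add_nat)
  moreover have "drl_less u' t'" "fib t' u'"
    using assms(2,3) by (simp_all add: t' u' drl_add_iff same_fiber_add_iff)
  ultimately have "reducible2 t'"
    unfolding reducible2_def by blast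
  moreover have "monom_dvd t' t"
    by (auto simp: monom_dvd_iff t' lookup_add)
  moreover have "t' \<noteq> t"
  proof
    assume "t' = t"
    then have "monom_degree t = 1 + monom_degree t"
      using t' by (metis monom_degree_add monom_degree_single)
    then show False by simp
  qed
  ultimately show ?thesis using that by blast
qed

text \<open>Trading \<open>ke\<close> variables for \<open>x\<^bsub>n+1\<^esub>\<^bsup>ke\<^esup>\<close> always decreases the monomial.\<close>

lemma reducible2_I:
  assumes t: "keys t \<subseteq> {2..n+1}" "lookup t (n + 1) = 0" and k: "k \<ge> (1::int)"
    and bound: "int (tail_weight t) + k * int (m 1) \<le> (int (tail_count t) - k * int e) * int (n - 1)"
  shows "reducible2 t"
proof -
  define r where "r = nat (int (tail_count t) - k * int e)"
  define w where "w = nat (int (tail_weight t) + k * int (m 1))"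
  have ka: "k * int (m 1) > 0" and ke: "k * int e > 0"
    using k m1_pos e_pos by simp_all
  then have "0 < (int (tail_count t) - k * int e) * int (n - 1)"
    using bound by linarith
  then have r0: "0 < int (tail_count t) - k * int e"
    using n by (simp add: zero_less_mult_iff)
  have r: "int r = int (tail_count t) - k * int e" and w: "int w = int (tail_weight t) + k * int (m 1)"
    using r0 ka by (simp_all add: r_def w_def)
  have "int r \<le> int w"
    unfolding r w using tail_bounds(1)[of t] ka ke by linarith
  moreover have "int w \<le> int (r * (n - 1))"
    unfolding of_nat_mult r w by (rule bound)
  ultimately obtain u where u: "keys u \<subseteq> {2..n}" "tail_count u = r" "tail_weight u = w"
    using tail_realizable[of r w] by (metis of_nat_le_iff)
  define v where "v = u + single (n + 1) (nat (k * int e))"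
  have kv: "keys v \<subseteq> {2..n+1}"
    using u(1) n by (auto simp: v_def keys_add_nat)
  have uz: "lookup u (n + 1) = 0" "lookup u 1 = 0"
    using u(1) by (auto simp: not_in_keys_iff_lookup_eq_zero subset_iff)
  have v: "lookup v 1 = 0" "lookup v (n + 1) = nat (k * int e)" "tail_count v = r" "tail_weight v = w"
    using u uz n by (simp_all add: v_def lookup_add lookup_single when_def tail_count_add
        tail_weight_add tail_single)
  have f: "fib t v"
  proof (rule fiberI[where l = 0 and k = k])
    show "keys t \<subseteq> {1..n+1}" "keys v \<subseteq> {1..n+1}"
      using t(1) kv by auto
    show "int (lookup v 1) = int (lookup t 1) + 0 * int h"
      using keys_2_lookup[OF t(1)] v(1) by simp
    show "int (tail_weight v) = int (tail_weight t) + k * int (m 1)"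
      "int (tail_count v) = int (tail_count t) - 0 - k * int e"
      using v r w by simp_all
    show "lookup t 1 + tail_count t + lookup t (n + 1) = lookup v 1 + tail_count v + lookup v (n + 1)"
      unfolding v using keys_2_lookup[OF t(1)] t(2) r ke by linarith
  qed
  moreover have "drl_less v t"
  proof (rule drl_lessI_top[of _ _ "n + 1"])
    show "monom_degree v = monom_degree t"
      using f by (simp add: same_fiber_def)
    show "lookup t (n + 1) < lookup v (n + 1)"
      unfolding v t(2) using ke by simp
    show "lookup v j = lookup t j" if "j > n + 1" for j
      by (simp only: lookup_above[OF keys_2_subset[OF kv] that] lookup_above[OF keys_2_subset[OF t(1)] that])
  qed
  ultimately show ?thesis
    unfolding reducible2_def using kv by blast
qed

text \<open>Spreading the indices to i-1 and j+1 keeps the tail weight, and x_{j+1} makes the result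
  smaller.\<close>

lemma reducible2_quadric:
  assumes "3 \<le> i" "i \<le> j" "j \<le> n - 1"
  shows "reducible2 (single i 1 + single j 1)"
proof -
  let ?t = "single i 1 + single j 1 :: nat monom" and ?u = "single (i - 1) 1 + single (j + 1) 1 :: nat monom"
  have k: "keys ?t \<subseteq> {2..n+1}" "keys ?u \<subseteq> {2..n+1}"
    using assms by (auto simp: keys_add_nat)
  have l: "lookup ?t 1 = 0" "lookup ?t (n + 1) = 0" "lookup ?u 1 = 0" "lookup ?u (n + 1) = 0"
    "tail_count ?t = 2" "tail_count ?u = 2" "tail_weight ?t = i - 1 + (j - 1)"
    "tail_weight ?u = i - 2 + j"
    using assms n by (auto simp: lookup_sum_single tail_count_add tail_weight_add tail_single)
  have f: "fib ?t ?u"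
  proof (rule fiberI[where l = 0 and k = 0])
    show "keys ?t \<subseteq> {1..n+1}" "keys ?u \<subseteq> {1..n+1}"
      using k by (auto intro: keys_2_subset)
    show "int (tail_weight ?u) = int (tail_weight ?t) + 0 * int (m 1)"
      unfolding l using assms by simp
  qed (unfold l, simp_all)
  moreover have "drl_less ?u ?t"
  proof (rule drl_lessI_top[of _ _ "j + 1"])
    show "monom_degree ?u = monom_degree ?t"
      using f by (simp add: same_fiber_def)
    show "lookup ?t (j + 1) < lookup ?u (j + 1)"
      using assms unfolding lookup_sum_single by simp
    show "lookup ?u x = lookup ?t x" if "x > j + 1" for x
      using assms that unfolding lookup_sum_single by simp
  qed
  ultimately show ?thesis
    unfolding reducible2_def using k by blast
qed

text \<open>\<open>tail_bounds\<close> for the cofactor of x_c, which sharpens the bounds for a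
  monomial containing x_c.\<close>

lemma tail_index_le:
  assumes "keys z \<subseteq> {1..n+1}" "2 \<le> c" "c \<le> n" "lookup z c > 0"
  shows "c - 1 + tail_count z \<le> tail_weight z + 1"
    and "tail_weight z + (n - 1) \<le> tail_count z * (n - 1) + (c - 1)"
proof -
  from assms(4) obtain u where u: "z = single c 1 + u"
    using split_variable[of 1 z c] by auto
  have z: "tail_count z = 1 + tail_count u" "tail_weight z = c - 1 + tail_weight u"
    using assms by (simp_all add: u tail_count_add tail_weight_add tail_single)
  show "c - 1 + tail_count z \<le> tail_weight z + 1"
    using tail_bounds(1)[of u] by (simp add: z)
  show "tail_weight z + (n - 1) \<le> tail_count z * (n - 1) + (c - 1)"
    using tail_bounds(2)[of u] by (simp add: z)
qed

text \<open>The excess of tail weight over tail count is i-2, and a factor x_c uses c-2 of it. So no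
  index exceeds i, and a monomial containing x_i has only x_2 left. All others lack x_i and are
  larger in the order.\<close>

lemma stretched_monomial_min:
  assumes i: "2 \<le> i" "i \<le> n - 1"
    and z: "keys z \<subseteq> {1..n+1}" "lookup z 1 = 0" "lookup z (n + 1) = 0"
      "tail_count z = \<alpha> + 1" "tail_weight z = \<alpha> + i - 1"
  shows "z = single 2 \<alpha> + single i 1 \<or> drl_less (single 2 \<alpha> + single i 1) z"
proof (cases "lookup z i > 0")
  case True
  then obtain u where u: "z = single i 1 + u"
    using split_variable[of 1 z i] by auto
  have "keys u \<subseteq> {1..n+1}"
    using z(1) by (simp add: u keys_add_nat)
  moreover have "lookup u 1 = 0" "lookup u (n + 1) = 0"
    using z(2,3) by (auto simp: u lookup_add)
  moreover have "tail_count u = \<alpha>" "tail_weight u = \<alpha>"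
    using z(4,5) i n by (auto simp: u tail_count_add tail_weight_add tail_single split: if_splits)
  ultimately have "u = single 2 \<alpha>"
    using tail_count_eq_weight[of u] by simp
  then show ?thesis
    by (simp add: u add.commute)
next
  case False
  have above: "lookup z c = 0" if "c > i" for c
  proof (rule ccontr)
    assume c: "lookup z c \<noteq> 0"
    with z(1) have "c \<in> {1..n+1}"
      by (auto simp: in_keys_iff subset_iff)
    moreover have "c \<noteq> n + 1"
      using c z(3) by auto
    ultimately have "c - 1 + tail_count z \<le> tail_weight z + 1"
      using c that i z(1) by (intro tail_index_le(1)) auto
    then show False
      using z(4,5) that i by simp
  qed
  have "monom_degree z = \<alpha> + 1"
    using degree_eq[OF z(1)] z by simp
  then have "drl_less (single 2 \<alpha> + single i 1) z"
    using False above i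
    by (intro drl_lessI_top[of _ _ i]) (auto simp: monom_degree_add lookup_sum_single)
  then show ?thesis ..
qed

text \<open>Cancelling a shared variable leaves two monomials of degree 1 in one fiber, which
  coincide.\<close>

lemma degree_2_component:
  assumes w: "keys w \<subseteq> {1..n+1}" "monom_degree w = 2"
  shows "component w {w}"
proof -
  have "z = w" if z: "keys z \<subseteq> {1..n+1}" "fib w z" "lookup w x > 0" "lookup z x > 0" for z x
  proof -
    from z(3) obtain w' where w': "w = single x 1 + w'"
      using split_variable[of 1 w x] by auto
    from z(4) obtain z' where z': "z = single x 1 + z'"
      using split_variable[of 1 z x] by auto
    have "w' = z'"
    proof (rule fiber_degree_1)
      show "keys w' \<subseteq> {1..n+1}" "keys z' \<subseteq> {1..n+1}"
        using w(1) z(1) by (simp_all add: w' z' keys_add_nat)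
      show "monom_degree w' = 1"
        using w(2) by (simp add: w' monom_degree_add)
      show "fib w' z'"
        using z(2) by (simp add: w' z' same_fiber_add_iff)
    qed
    then show ?thesis by (simp add: w' z')
  qed
  then show ?thesis
    unfolding component_def using w(1) same_fiber_refl by blast
qed

text \<open>A smaller witness \<open>u\<close> is disjoint from \<open>w\<close>, which rules out
  x_{n+1} and x_n in \<open>w\<close>. Two factors x_i, x_j with indices from 3 to n-1 would form a
  proper reducible divisor, as the degree is at least 3. So at most one factor differs from
  x_2.\<close>

lemma minimal_reducible_shape:
  assumes w: "keys w \<subseteq> {2..n+1}" "reducible2 w" and deg: "monom_degree w \<ge> 3"
    and min: "\<And>v. monom_dvd v w \<Longrightarrow> v \<noteq> w \<Longrightarrow> \<not> reducible2 v"
  obtains \<alpha> i where "w = single 2 \<alpha> + single i 1" "2 \<le> i" "i \<le> n - 1"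
proof -
  obtain u where u: "keys u \<subseteq> {2..n+1}" "drl_less u w" "fib w u"
    using w(2) unfolding reducible2_def by blast
  have disj: "lookup w x = 0 \<or> lookup u x = 0" for x
    using reducible2_cancel[OF u, of x] min by blast
  have dege: "monom_degree u = monom_degree w"
    using u(3) by (simp add: same_fiber_def)
  have above: "lookup u j = lookup w j" if "j > n + 1" for j
    by (simp only: lookup_above[OF keys_2_subset[OF u(1)] that] lookup_above[OF keys_2_subset[OF w(1)] that])
  have "lookup w (n + 1) \<le> lookup u (n + 1)"
    using drl_top_le[OF u(2) dege above] .
  then have wn1: "lookup w (n + 1) = 0"
    using disj[of "n + 1"] by auto
  \<comment> \<open>If x_n were in \<open>w\<close>, the disjoint smaller \<open>u\<close> would
    have to contain x_{n+1}, giving k >= 1. Removing x_n lowers both sides of the bound in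
    \<open>reducible2_I\<close> by n-1, so the cofactor would already be reducible.\<close>
  have wn: "lookup w n = 0"
  proof (rule ccontr)
    assume pos: "lookup w n \<noteq> 0"
    obtain k l where kl: "int (lookup u 1) = int (lookup w 1) + l * int h"
      "int (tail_weight u) = int (tail_weight w) + k * int (m 1)"
      "int (tail_count u) = int (tail_count w) - l - k * int e"
      "lookup w 1 + tail_count w + lookup w (n + 1) = lookup u 1 + tail_count u + lookup u (n + 1)"
      using fiber_params[OF keys_2_subset[OF w(1)] keys_2_subset[OF u(1)] u(3)] .
    have "l = 0"
      using kl(1) keys_2_lookup[OF w(1)] keys_2_lookup[OF u(1)] h by simp
    have "lookup u (n + 1) > 0"
    proof (rule ccontr)
      assume "\<not> ?thesis"
      then have "lookup u j = lookup w j" if "j > n" for j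
        using that above[of j] wn1 by (cases "j = n + 1") auto
      then have "lookup w n \<le> lookup u n"
        using drl_top_le[OF u(2) dege] by blast
      with pos disj[of n] show False by auto
    qed
    then have "0 < k * int e"
      using kl(3,4) \<open>l = 0\<close> wn1 keys_2_lookup[OF w(1)] keys_2_lookup[OF u(1)] by linarith
    then have k: "k \<ge> 1"
      using e_pos by (simp add: zero_less_mult_iff)
    obtain v where v: "w = single n 1 + v"
      using split_variable[of 1 w n] pos by auto
    have wv: "tail_count w = 1 + tail_count v" "tail_weight w = n - 1 + tail_weight v"
      using n by (simp_all add: v tail_count_add tail_weight_add tail_single)
    have "reducible2 v"
    proof (rule reducible2_I[OF _ _ k])
      show "keys v \<subseteq> {2..n+1}" "lookup v (n + 1) = 0"
        using w(1) wn1 by (simp_all add: v keys_add_nat lookup_add)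
      have "int (tail_weight u) \<le> int (tail_count u) * int (n - 1)"
        using tail_bounds(2)[of u] by (metis of_nat_le_iff of_nat_mult)
      then show "int (tail_weight v) + k * int (m 1) \<le> (int (tail_count v) - k * int e) * int (n - 1)"
        unfolding kl(2,3) wv \<open>l = 0\<close> by (simp add: algebra_simps)
    qed
    moreover have "monom_dvd v w"
      by (auto simp: monom_dvd_iff v lookup_add)
    moreover have "v \<noteq> w"
      using wv by auto
    ultimately show False using min by blast
  qed
  have no_quadric: False if dvd: "w = single i 1 + (single j 1 + v)" and ij: "3 \<le> i" "i \<le> j" "j \<le> n - 1" for i j v
  proof -
    have "monom_dvd (single i 1 + single j 1) w"
      unfolding dvd monom_dvd_iff by (simp add: lookup_add)
    moreover have "single i 1 + single j 1 \<noteq> w"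
      using deg by (auto simp: monom_degree_add)
    ultimately show False
      using min reducible2_quadric[OF ij] by blast
  qed
  have range: "2 \<le> x \<and> x \<le> n - 1" if "lookup w x > 0" for x
  proof -
    have "x \<in> {2..n+1}"
      using that w(1) by (auto simp: in_keys_iff subset_iff)
    moreover have "x \<noteq> n + 1" "x \<noteq> n"
      using that wn1 wn by auto
    ultimately show ?thesis by auto
  qed
  have only2: "v = single 2 (lookup v 2)" if "\<And>x. lookup v x > 0 \<Longrightarrow> x = 2" for v :: "nat monom"
    by (rule poly_mapping_eqI) (use that in \<open>force simp: lookup_single when_def\<close>)
  show ?thesis
  proof (cases "\<exists>i\<ge>3. lookup w i > 0")
    case True
    then obtain i where i: "3 \<le> i" "lookup w i > 0" by blast
    then obtain v where v: "w = single i 1 + v"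
      using split_variable[of 1 w i] by auto
    have "x = 2" if "lookup v x > 0" for x
    proof (rule ccontr)
      assume "x \<noteq> 2"
      from that obtain v' where v': "v = single x 1 + v'"
        using split_variable[of 1 v x] by auto
      have x: "3 \<le> x" "x \<le> n - 1" and i': "i \<le> n - 1"
        using range[of x] range[OF i(2)] that \<open>x \<noteq> 2\<close> by (auto simp: v lookup_add)
      have w1: "w = single i 1 + (single x 1 + v')" and w2: "w = single x 1 + (single i 1 + v')"
        by (simp_all add: v v' add.left_commute)
      show False
      proof (cases "i \<le> x")
        case True
        show False by (rule no_quadric[OF w1 i(1) True x(2)])
      next
        case False
        show False by (rule no_quadric[OF w2 x(1) _ i']) (use False in simp)
      qed
    qed
    then have "v = single 2 (lookup v 2)"
      by (rule only2)
    then have "w = single 2 (lookup v 2) + single i 1"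
      using v by (metis add.commute)
    moreover have "i \<le> n - 1"
      using range i(2) by blast
    ultimately show ?thesis
      using that i by auto
  next
    case False
    have "x = 2" if "lookup w x > 0" for x
    proof -
      have "\<not> 3 \<le> x" using False that by blast
      with range[OF that] show ?thesis by linarith
    qed
    then have w2: "w = single 2 (lookup w 2)"
      by (rule only2)
    then have "monom_degree w = lookup w 2"
      by (metis monom_degree_single)
    then have "lookup w 2 = (lookup w 2 - 1) + 1"
      using deg by simp
    then have "w = single 2 (lookup w 2 - 1) + single 2 1"
      using w2 by (metis single_add)
    with that n show ?thesis by simp
  qed
qed

text \<open>Degrees 0 and 1 admit no reduction, and degree 2 gives a singleton. From degree 3 on, w
  = x_2^alpha x_i, and \<open>S\<close> consists of the fiber members free of x_{n+1}.\<close>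

lemma old_lead_component:
  assumes w: "keys w \<subseteq> {2..n+1}" "reducible2 w"
    and min: "\<And>v. monom_dvd v w \<Longrightarrow> v \<noteq> w \<Longrightarrow> \<not> reducible2 v"
  shows "\<exists>S. component w S"
proof -
  obtain u where u: "keys u \<subseteq> {2..n+1}" "drl_less u w" "fib w u"
    using w(2) unfolding reducible2_def by blast
  have kw: "keys w \<subseteq> {1..n+1}" and ku: "keys u \<subseteq> {1..n+1}"
    using w(1) u(1) by (auto intro: keys_2_subset)
  have "u \<noteq> w"
    using u(2) drl_irrefl by blast
  have "monom_degree w \<noteq> 0"
  proof
    assume "monom_degree w = 0"
    then have "w = 0" "u = 0"
      using u(3) monom_degree_eq_0 by (auto simp: same_fiber_def)
    with \<open>u \<noteq> w\<close> show False by simp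
  qed
  moreover have "monom_degree w \<noteq> 1"
    using fiber_degree_1[OF kw ku _ u(3)] \<open>u \<noteq> w\<close> by blast
  ultimately consider "monom_degree w = 2" | "monom_degree w \<ge> 3"
    by linarith
  then show ?thesis
  proof cases
    case 1
    with kw show ?thesis by (blast intro: degree_2_component)
  next
    case 2
    obtain \<alpha> i where w_eq: "w = single 2 \<alpha> + single i 1" and i: "2 \<le> i" "i \<le> n - 1"
      using minimal_reducible_shape[OF w 2 min] .
    define N where "N = int (n - 1)"
    \<comment> \<open>The slack R(n-1) - T of a fiber member reached from \<open>w\<close> by l = 0,
      k = 1.\<close>
    define D where "D = (int (\<alpha> + 1) - int e) * N - int (\<alpha> + i - 1) - int (m 1)"
    have N: "N \<ge> 2" using n by (simp add: N_def)
    have wc: "lookup w 1 = 0" "lookup w (n + 1) = 0" "tail_count w = \<alpha> + 1" "tail_weight w = \<alpha> + i - 1"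
      using i by (auto simp: w_eq lookup_sum_single tail_count_add tail_weight_add tail_single)
    \<comment> \<open>As \<open>w\<close> contains neither x_1 nor x_{n+1}, both shifts are
      nonnegative; the last inequality is T <= R(n-1) expressed through the slack
      \<open>D\<close>.\<close>
    have params: "\<exists>k l. int (lookup z 1) = l * int h \<and> int (tail_weight z) = int (\<alpha> + i - 1) + k * int (m 1) \<and>
        int (tail_count z) = int (\<alpha> + 1) - l - k * int e \<and> k * int e = l * (int h - 1) + int (lookup z (n + 1)) \<and>
        l \<ge> 0 \<and> k \<ge> 0 \<and> (k - 1) * (int (m 1) + int e * N) + l * N \<le> D"
      if z: "keys z \<subseteq> {1..n+1}" "fib w z" for z
    proof -
      obtain k l where kl: "int (lookup z 1) = int (lookup w 1) + l * int h"
        "int (tail_weight z) = int (tail_weight w) + k * int (m 1)"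
        "int (tail_count z) = int (tail_count w) - l - k * int e"
        "lookup w 1 + tail_count w + lookup w (n + 1) = lookup z 1 + tail_count z + lookup z (n + 1)"
        using fiber_params[OF kw z] .
      have "int (lookup w 1 + tail_count w + lookup w (n + 1)) = int (lookup z 1 + tail_count z + lookup z (n + 1))"
        using kl(4) by simp
      then have ke: "k * int e = l * (int h - 1) + int (lookup z (n + 1))"
        using kl(1,3) wc by (simp add: algebra_simps)
      have "0 \<le> l * int h"
        using kl(1) wc by simp
      then have l: "l \<ge> 0"
        using h by (simp add: zero_le_mult_iff)
      then have "l * (int h - 1) \<ge> 0"
        using h by simp
      then have "0 \<le> k * int e"
        using ke by linarith
      then have k: "k \<ge> 0"
        using e_pos by (simp add: zero_le_mult_iff)
      have "int (tail_weight z) \<le> int (tail_count z) * N"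
        using tail_bounds(2)[of z] unfolding N_def by (metis of_nat_le_iff of_nat_mult)
      then have "(k - 1) * (int (m 1) + int e * N) + l * N \<le> D"
        unfolding kl(2,3) wc D_def by (simp add: algebra_simps)
      then show ?thesis
        using kl(1-3) wc ke k l by (intro exI[of _ k] exI[of _ l]) simp
    qed
    \<comment> \<open>For k = 0 the nonnegative terms l(h-1) and the exponent of x_{n+1} add up to
      0, so both vanish.\<close>
    have k0: "lookup z 1 = 0 \<and> lookup z (n + 1) = 0 \<and> tail_count z = \<alpha> + 1 \<and> tail_weight z = \<alpha> + i - 1"
      if "int (lookup z 1) = l * int h" "int (tail_weight z) = int (\<alpha> + i - 1) + k * int (m 1)"
        "int (tail_count z) = int (\<alpha> + 1) - l - k * int e" "k * int e = l * (int h - 1) + int (lookup z (n + 1))"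
        "l \<ge> 0" "k = 0" for z k l
    proof -
      have "l * (int h - 1) \<ge> 0"
        using that(5) h by simp
      moreover have "l * (int h - 1) + int (lookup z (n + 1)) = 0"
        using that(4,6) by simp
      ultimately have "l * (int h - 1) = 0" and x: "lookup z (n + 1) = 0"
        by linarith+
      then have "l = 0"
        using h by (auto simp: mult_eq_0_iff)
      then have "int (lookup z 1) = 0" "int (tail_count z) = int (\<alpha> + 1)" "int (tail_weight z) = int (\<alpha> + i - 1)"
        using that by simp_all
      with x show ?thesis
        by (simp only: of_nat_eq_iff of_nat_eq_0_iff)
    qed
    \<comment> \<open>By \<open>stretched_monomial_min\<close>, members with k = 0 do not lie below
      \<open>w\<close>; so the witness \<open>u\<close> has k >= 1.\<close>
    have D0: "0 \<le> D"
    proof -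
      obtain k l where kl: "int (lookup u 1) = l * int h" "int (tail_weight u) = int (\<alpha> + i - 1) + k * int (m 1)"
        "int (tail_count u) = int (\<alpha> + 1) - l - k * int e" "k * int e = l * (int h - 1) + int (lookup u (n + 1))"
        "l \<ge> 0" "k \<ge> 0" "(k - 1) * (int (m 1) + int e * N) + l * N \<le> D"
        using params[OF ku u(3)] by blast
      have "k \<noteq> 0"
      proof
        assume "k = 0"
        then have "u = w \<or> drl_less w u"
          using k0[OF kl(1-5)] stretched_monomial_min[OF i ku, of \<alpha>] unfolding w_eq by blast
        then show False
          using \<open>u \<noteq> w\<close> u(2) drl_asym by blast
      qed
      then have "(k - 1) * (int (m 1) + int e * N) \<ge> 0" "l * N \<ge> 0"
        using kl N by simp_all
      with kl(7) show ?thesis by linarith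
    qed
    \<comment> \<open>A larger slack would already make the proper divisor x_2^alpha reducible,
      against minimality.\<close>
    have D_less: "D < N - int (i - 1)"
    proof (rule ccontr)
      assume D: "\<not> ?thesis"
      have "reducible2 (single 2 \<alpha>)"
      proof (rule reducible2_I[of _ 1])
        show "keys (single 2 \<alpha>) \<subseteq> {2..n+1}" "lookup (single 2 \<alpha>) (n + 1) = 0"
          using n by (auto simp: lookup_single when_def)
        show "int (tail_weight (single 2 \<alpha>)) + 1 * int (m 1)
            \<le> (int (tail_count (single 2 \<alpha>)) - 1 * int e) * int (n - 1)"
          using D n i unfolding N_def[symmetric] D_def by (simp add: tail_single algebra_simps)
      qed simp
      moreover have "monom_dvd (single 2 \<alpha>) w"
        unfolding w_eq monom_dvd_iff by (simp add: lookup_add)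
      moreover have "single 2 \<alpha> \<noteq> w"
        using wc(3) n by (auto simp: tail_single)
      ultimately show False
        using min by blast
    qed
    \<comment> \<open>A member with k >= 1 and no x_{n+1} needs l >= 1, hence slack at least N,
      which \<open>D_less\<close> forbids. So all of \<open>?S\<close> has k = 0. A monomial sharing
      some x_x with a member has x <= i, and k >= 1 would by \<open>tail_index_le\<close> need slack
      at least N - (x-1), again too much.\<close>
    let ?S = "{z. keys z \<subseteq> {1..n+1} \<and> fib w z \<and> lookup z (n + 1) = 0}"
    have S: "lookup z 1 = 0 \<and> lookup z (n + 1) = 0 \<and> tail_count z = \<alpha> + 1 \<and> tail_weight z = \<alpha> + i - 1"
      if z: "z \<in> ?S" for z
    proof -
      obtain k l where kl: "int (lookup z 1) = l * int h" "int (tail_weight z) = int (\<alpha> + i - 1) + k * int (m 1)"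
        "int (tail_count z) = int (\<alpha> + 1) - l - k * int e" "k * int e = l * (int h - 1) + int (lookup z (n + 1))"
        "l \<ge> 0" "k \<ge> 0" "(k - 1) * (int (m 1) + int e * N) + l * N \<le> D"
        using params[of z] z by blast
      have "k = 0"
      proof (rule ccontr)
        assume "k \<noteq> 0"
        with kl have "k \<ge> 1" by simp
        then have "(k - 1) * (int (m 1) + int e * N) \<ge> 0"
          using N by simp
        then have "l * N < 1 * N"
          using kl(7) D_less by linarith
        then have "l = 0"
          using kl(5) N by (simp add: mult_less_cancel_right)
        then have "k * int e = 0"
          using kl(4) z by simp
        with \<open>k \<noteq> 0\<close> e_pos show False by simp
      qed
      with k0[OF kl(1-5)] show ?thesis .
    qed
    have "component w ?S"
      unfolding component_def
    proof (intro conjI ballI allI impI)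
      show "w \<in> ?S"
        using kw wc same_fiber_refl by simp
    next
      fix z assume z: "z \<in> ?S" "z \<noteq> w"
      then have "keys z \<subseteq> {1..n+1}"
        by blast
      from stretched_monomial_min[OF i this, of \<alpha>] S[OF z(1)]
      have "z = w \<or> drl_less w z"
        unfolding w_eq by simp
      with z(2) show "drl_less w z" by simp
    next
      fix z z' assume z: "z \<in> ?S" and z': "keys z' \<subseteq> {1..n+1}" "fib z z'"
        and "\<exists>x. 0 < lookup z x \<and> 0 < lookup z' x"
      then obtain x where x: "0 < lookup z x" "0 < lookup z' x" by blast
      have zc: "lookup z 1 = 0" "lookup z (n + 1) = 0" "tail_count z = \<alpha> + 1" "tail_weight z = \<alpha> + i - 1"
        using S[OF z] by simp_all
      have kz: "keys z \<subseteq> {1..n+1}"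
        using z by simp
      have f: "fib w z'"
        using z z'(2) same_fiber_trans by blast
      have "x \<in> {1..n+1}" "x \<noteq> 1" "x \<noteq> n + 1"
        using kz x(1) zc by (auto simp: in_keys_iff subset_iff)
      then have x': "2 \<le> x" "x \<le> n" by auto
      have "x - 1 + tail_count z \<le> tail_weight z + 1"
        by (rule tail_index_le(1)[OF kz x' x(1)])
      then have xi: "x \<le> i"
        using zc(3,4) i x' by simp
      obtain k l where kl: "int (lookup z' 1) = l * int h" "int (tail_weight z') = int (\<alpha> + i - 1) + k * int (m 1)"
        "int (tail_count z') = int (\<alpha> + 1) - l - k * int e" "k * int e = l * (int h - 1) + int (lookup z' (n + 1))"
        "l \<ge> 0" "k \<ge> 0" "(k - 1) * (int (m 1) + int e * N) + l * N \<le> D"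
        using params[OF z'(1) f] by blast
      have "k = 0"
      proof (rule ccontr)
        assume "k \<noteq> 0"
        with kl have k: "k \<ge> 1" by simp
        have "int (tail_weight z' + (n - 1)) \<le> int (tail_count z' * (n - 1) + (x - 1))"
          using tail_index_le(2)[OF z'(1) x' x(2)] by (simp only: of_nat_le_iff)
        then have "int (tail_weight z') + N \<le> int (tail_count z') * N + int (x - 1)"
          by (simp add: N_def)
        then have "(k - 1) * (int (m 1) + int e * N) + l * N + N \<le> D + int (x - 1)"
          unfolding kl(2,3) D_def by (simp add: algebra_simps)
        moreover have "(k - 1) * (int (m 1) + int e * N) \<ge> 0" "l * N \<ge> 0"
          using k kl(5) N by simp_all
        moreover have "int (x - 1) \<le> int (i - 1)"
          using xi by simp
        ultimately show False
          using D_less by linarith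
      qed
      with k0[OF kl(1-5)] z'(1) f show "z' \<in> ?S" by simp
    qed auto
    then show ?thesis by blast
  qed
qed

text \<open>If u t0 lies in \<open>S\<close>, every u t with t in the fiber of t0 shares a variable
  of \<open>u\<close> with it, hence lies in \<open>S\<close> too. The functional therefore
  restricts to a full fiber sum of \<open>b\<close>.\<close>

lemma component_functional:
  fixes b :: "(nat, 'k::field) mpoly"
  assumes S: "component w S" and u: "u \<noteq> 0" "keys u \<subseteq> {1..n+1}" and b: "b \<in> curve_ideal 1 n m"
  shows "linear_ext (\<lambda>t. if u + t \<in> S then 1 else 0) b = 0"
proof (cases "\<exists>t0. u + t0 \<in> S")
  case True
  then obtain t0 where t0: "u + t0 \<in> S" by blast
  have fibS: "fib w z" if "z \<in> S" for z
    using S that unfolding component_def by blast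
  obtain x where x: "lookup u x > 0"
    using u(1) by (metis gr_zeroI lookup_zero poly_mapping_eqI)
  have "u + t \<in> S \<longleftrightarrow> fib t0 t" if "keys t \<subseteq> {1..n+1}" for t
  proof
    assume "u + t \<in> S"
    then have "fib (u + t0) (u + t)"
      using fibS t0 same_fiber_sym same_fiber_trans by blast
    then show "fib t0 t" by (simp add: same_fiber_add_iff)
  next
    assume "fib t0 t"
    then have "fib (u + t0) (u + t)" by (simp add: same_fiber_add_iff)
    moreover have "keys (u + t) \<subseteq> {1..n+1}"
      using that u(2) by (simp add: keys_add_nat)
    moreover have "lookup (u + t0) x > 0 \<and> lookup (u + t) x > 0"
      using x by (simp add: lookup_add)
    ultimately show "u + t \<in> S"
      using S t0 unfolding component_def by blast
  qed
  then have "linear_ext (\<lambda>t. if u + t \<in> S then 1 else 0) b = linear_ext (\<lambda>t. if fib t0 t then 1 else 0) b"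
    using b by (intro linear_ext_cong) (auto simp: curve_ideal_def polys_in_def)
  then show ?thesis
    using curve_ideal_fiber_sum[OF m_le mn_pos b, of t0] by simp
qed (simp add: linear_ext_def)


section \<open>The initial ideal of I(C) and the added binomials\<close>

lemma finite_fiber: "finite {z. keys z \<subseteq> {1..n+1} \<and> fib t z}"
  by (rule finite_subset[OF _ finite_monoms_bounded[of "{1..n+1}" "monom_degree t"]])
    (auto simp: same_fiber_def)

text \<open>The comparison is with the least monomial \<open>u0\<close> of the fiber, not with
  \<open>u\<close>. This excludes a larger exponent of x_1 in \<open>u0\<close>: a new leading
  monomial would divide \<open>u0\<close> and permit a further reduction. A smaller exponent gives a
  new leading monomial dividing \<open>t\<close>, and for equal exponents x_1 cancels.\<close>

lemma reducible_divisor: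
  assumes t: "keys t \<subseteq> {1..n+1}" and u: "keys u \<subseteq> {1..n+1}" "drl_less u t" "fib t u"
  obtains w where "w \<in> new_leads" "monom_dvd w t"
    | v where "keys v \<subseteq> {2..n+1}" "reducible2 v" "monom_dvd v t"
proof -
  let ?F = "{z. keys z \<subseteq> {1..n+1} \<and> fib t z}"
  have ne: "?F \<noteq> {}"
    using t same_fiber_refl by blast
  have "\<exists>u0\<in>?F. \<forall>z\<in>?F. z \<noteq> u0 \<longrightarrow> drl_less u0 z"
    by (rule drl_min_exists[OF finite_fiber[of t] ne]) blast
  then obtain u0 where u0: "u0 \<in> ?F" and min: "\<forall>z\<in>?F. z \<noteq> u0 \<longrightarrow> drl_less u0 z"
    by blast
  from u0 have k0: "keys u0 \<subseteq> {1..n+1}" and f0: "fib t u0"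
    by simp_all
  have less: "drl_less u0 t"
  proof (cases "u = u0")
    case True
    with u(2) show ?thesis by simp
  next
    case False
    then have "drl_less u0 u"
      using min u by blast
    then show ?thesis using u(2) by (rule drl_trans)
  qed
  consider "lookup u0 1 < lookup t 1" | "lookup t 1 < lookup u0 1" | "lookup t 1 = lookup u0 1"
    by linarith
  then show ?thesis
  proof cases
    case 1
    with new_lead_divides[OF t k0 f0] that(1) show ?thesis by blast
  next
    case 2
    with new_lead_divides[OF k0 t same_fiber_sym[OF f0]]
    obtain w v where w: "w \<in> new_leads" and v: "u0 = w + v"
      unfolding monom_dvd_def by blast
    obtain w' where w': "keys w' \<subseteq> {1..n+1}" "fib w w'" "drl_less w' w"
      using w by (rule new_leads_reducible)
    have "fib (v + w) (v + w')" "drl_less (v + w') (v + w)"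
      using w' by (simp_all add: same_fiber_add_iff drl_add_iff)
    then have "fib t (v + w')" "drl_less (v + w') u0"
      using f0 same_fiber_trans by (auto simp: v add.commute)
    moreover have "keys (v + w') \<subseteq> {1..n+1}"
      using w'(1) k0 by (simp add: v keys_add_nat)
    ultimately have "v + w' \<in> ?F" "drl_less (v + w') u0"
      by simp_all
    moreover from this(2) have "v + w' \<noteq> u0"
      using drl_irrefl by metis
    ultimately have "drl_less u0 (v + w')" "drl_less (v + w') u0"
      using min by simp_all
    then show ?thesis
      using drl_asym by blast
  next
    case 3
    obtain t' where t': "t = single 1 (lookup t 1) + t'"
      using split_variable[OF le_refl] .
    obtain u' where u': "u0 = single 1 (lookup t 1) + u'"
      using split_variable[of "lookup t 1" u0 1] 3 by auto
    have keys2: "keys x \<subseteq> {2..n+1}" if "keys x \<subseteq> {1..n+1}" "lookup x 1 = 0" for x :: "nat monom"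
    proof
      fix i assume "i \<in> keys x"
      moreover from this have "i \<noteq> 1"
        using that(2) by (auto simp: in_keys_iff)
      ultimately show "i \<in> {2..n+1}"
        using that(1) by force
    qed
    have "lookup t 1 = lookup t 1 + lookup t' 1"
      by (subst t') (simp add: lookup_add)
    moreover have "lookup u0 1 = lookup t 1 + lookup u' 1"
      by (subst u') (simp add: lookup_add)
    ultimately have z: "lookup t' 1 = 0" "lookup u' 1 = 0"
      using 3 by simp_all
    have "keys t' \<subseteq> keys t" "keys u' \<subseteq> keys u0"
      by (subst t', simp add: keys_add_nat) (subst u', simp add: keys_add_nat)
    then have k: "keys t' \<subseteq> {2..n+1}" "keys u' \<subseteq> {2..n+1}"
      using t k0 z by (meson keys2 subset_trans)+
    have "drl_less u' t'" "fib t' u'"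
      using less f0 t' u' by (metis drl_add_iff, metis same_fiber_add_iff)
    then have "reducible2 t'"
      unfolding reducible2_def using k by blast
    moreover have "monom_dvd t' t"
      by (subst t') (simp add: monom_dvd_iff lookup_add)
    ultimately show ?thesis
      using that(2) k by blast
  qed
qed

definition new_basis :: "(nat, 'k::field) mpoly set" where
  "new_basis = (\<lambda>i. monomial (new_lead1 i) - monomial (new_trail1 i)) ` {3..n}
    \<union> (\<lambda>j. monomial (new_lead2 j) - monomial (new_trail2 j)) ` {1..p + e + 1}"

lemma new_basis_eq:
  "(new_basis :: (nat, 'k::field) mpoly set) = {X 1 ^ h * X i - X 2 * X (i - 1) * X (n + 1) ^ (h - 1) | i. 3 \<le> i \<and> i \<le> n}
      \<union> {X 1 ^ (j * h) * X 2 ^ beta n m h d p j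
            - X (sigma n m h d p s j) * X n ^ lambda n m h d p s j
                * X (n + 1) ^ (j * (h - 1) + d div h) | j. 1 \<le> j \<and> j \<le> delta h d p div h}"
proof -
  have X: "X i = (monomial (single i 1) :: (nat, 'k::field) mpoly)" for i
    by (simp add: X_def)
  have "X 1 ^ h * X i - X 2 * X (i - 1) * X (n + 1) ^ (h - 1)
      = (monomial (new_lead1 i) - monomial (new_trail1 i) :: (nat, 'k) mpoly)" for i
    unfolding X_power unfolding X monomial_mult new_lead1_def new_trail1_def ..
  moreover have "X 1 ^ (j * h) * X 2 ^ beta n m h d p j
        - X (sigma n m h d p s j) * X n ^ lambda n m h d p s j * X (n + 1) ^ (j * (h - 1) + d div h)
      = (monomial (new_lead2 j) - monomial (new_trail2 j) :: (nat, 'k) mpoly)" for j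
    unfolding X_power unfolding X monomial_mult new_lead2_def new_trail2_def e_def ..
  ultimately show ?thesis
    unfolding new_basis_def delta_div by auto
qed

lemma new_basis_elem:
  fixes g :: "(nat, 'k::field) mpoly"
  assumes "g \<in> new_basis"
  shows "lead_monom g \<in> new_leads" "leading_coefficient g = 1" "g \<in> curve_ideal 1 n m"
proof -
  from assms consider (1) i where "g = monomial (new_lead1 i) - monomial (new_trail1 i)" "3 \<le> i" "i \<le> n"
    | (2) j where "g = monomial (new_lead2 j) - monomial (new_trail2 j)" "1 \<le> j" "j \<le> p + e + 1"
    unfolding new_basis_def by auto
  then have "lead_monom g \<in> new_leads \<and> leading_coefficient g = 1 \<and> g \<in> curve_ideal 1 n m"
  proof cases
    case 1
    note N = new1[OF 1(2,3)]
    have "new_lead1 i \<in> new_leads"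
      using 1 by (auto simp: new_leads_def)
    then show ?thesis
      unfolding 1(1) lead_monom_binomial[OF N(4)]
      using curve_ideal_binomial[OF m_le mn_pos same_fiber_sym[OF N(3)] N(2,1)] by simp
  next
    case 2
    note N = new2[OF 2(2,3)]
    have "new_lead2 j \<in> new_leads"
      using 2 by (auto simp: new_leads_def)
    then show ?thesis
      unfolding 2(1) lead_monom_binomial[OF N(4)]
      using curve_ideal_binomial[OF m_le mn_pos same_fiber_sym[OF N(3)] N(2,1)] by simp
  qed
  then show "lead_monom g \<in> new_leads" "leading_coefficient g = 1" "g \<in> curve_ideal 1 n m"
    by simp_all
qed

lemma new_basis_surj:
  assumes "w \<in> new_leads"
  obtains g :: "(nat, 'k::field) mpoly" where "g \<in> new_basis" "lead_monom g = w"
proof -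
  from assms consider (1) i where "w = new_lead1 i" "3 \<le> i" "i \<le> n"
    | (2) j where "w = new_lead2 j" "1 \<le> j" "j \<le> p + e + 1"
    unfolding new_leads_def by auto
  then show ?thesis
  proof cases
    case 1
    show ?thesis
      using lead_monom_binomial(1)[OF new1(4)[OF 1(2,3)]] 1
      by (intro that[of "monomial (new_lead1 i) - monomial (new_trail1 i)"]) (auto simp: new_basis_def)
  next
    case 2
    show ?thesis
      using lead_monom_binomial(1)[OF new2(4)[OF 2(2,3)]] 2
      by (intro that[of "monomial (new_lead2 j) - monomial (new_trail2 j)"]) (auto simp: new_basis_def)
  qed
qed

text \<open>The index i >= 3 is visible as a variable in the first family and no such variable
  occurs in the second, where j is read off the exponent of x_1.\<close>

lemma new_basis_inj: "inj_on lead_monom (new_basis :: (nat, 'k::field) mpoly set)"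
proof -
  have l1: "lookup (new_lead1 i) x = (if x = i then 1 else 0)" if "3 \<le> i" "3 \<le> x" for i x
    using that by (simp add: new_lead1_def lookup_sum_single)
  have l2: "lookup (new_lead2 j) x = 0" if "3 \<le> x" for j x
    using that by (simp add: new_lead2_def lookup_sum_single)
  have 11: "i = i'" if "new_lead1 i = new_lead1 i'" "3 \<le> i" "3 \<le> i'" for i i'
  proof -
    from that(1) have "lookup (new_lead1 i) i = lookup (new_lead1 i') i" by (rule arg_cong)
    then have "(if i = i then 1 else 0 :: nat) = (if i = i' then 1 else 0)"
      unfolding l1[OF that(2,2)] l1[OF that(3,2)] .
    then show ?thesis by (simp split: if_splits)
  qed
  have 12: "new_lead1 i \<noteq> new_lead2 j" if "3 \<le> i" for i j
  proof
    assume "new_lead1 i = new_lead2 j"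
    then have "lookup (new_lead1 i) i = lookup (new_lead2 j) i" by (rule arg_cong)
    then show False
      unfolding l1[OF that that] l2[OF that] by simp
  qed
  have 22: "j = j'" if "new_lead2 j = new_lead2 j'" for j j'
  proof -
    have "lookup (new_lead2 j) 1 = j * h" for j
      by (simp add: new_lead2_def lookup_sum_single)
    then have "j * h = j' * h"
      using that by metis
    with h show ?thesis by simp
  qed
  let ?b1 = "\<lambda>i. monomial (new_lead1 i) - monomial (new_trail1 i) :: (nat, 'k) mpoly"
  let ?b2 = "\<lambda>j. monomial (new_lead2 j) - monomial (new_trail2 j) :: (nat, 'k) mpoly"
  have lm1: "lead_monom (?b1 i) = new_lead1 i" if "i \<in> {3..n}" for i
    using that lead_monom_binomial(1)[OF new1(4)] by auto
  have lm2: "lead_monom (?b2 j) = new_lead2 j" if "j \<in> {1..p+e+1}" for j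
    using that lead_monom_binomial(1)[OF new2(4)] by auto
  show ?thesis
  proof (rule inj_onI)
    fix f g :: "(nat, 'k) mpoly"
    assume fg: "f \<in> new_basis" "g \<in> new_basis" and eq: "lead_monom f = lead_monom g"
    from fg consider (a) i i' where "f = ?b1 i" "g = ?b1 i'" "i \<in> {3..n}" "i' \<in> {3..n}"
      | (b) i j where "f = ?b1 i" "g = ?b2 j" "i \<in> {3..n}" "j \<in> {1..p+e+1}"
      | (c) i j where "f = ?b2 j" "g = ?b1 i" "i \<in> {3..n}" "j \<in> {1..p+e+1}"
      | (d) j j' where "f = ?b2 j" "g = ?b2 j'" "j \<in> {1..p+e+1}" "j' \<in> {1..p+e+1}"
      unfolding new_basis_def by (elim UnE imageE) blast+
    then show "f = g"
    proof cases
      case a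
      then have "new_lead1 i = new_lead1 i'" using eq lm1 by simp
      with 11[of i i'] a show ?thesis by simp
    next
      case b
      then have "new_lead1 i = new_lead2 j" using eq lm1 lm2 by simp
      with 12[of i j] b show ?thesis by simp
    next
      case c
      then have "new_lead1 i = new_lead2 j" using eq lm1 lm2 by simp
      with 12[of i j] c show ?thesis by simp
    next
      case d
      then have "new_lead2 j = new_lead2 j'" using eq lm2 by simp
      with 22[of j j'] d show ?thesis by simp
    qed
  qed
qed

lemma curve_ideal_closed_gen:
  assumes "G \<subseteq> curve_ideal 1 n m"
  shows "ideal_gen {1..n+1} G \<subseteq> (curve_ideal 1 n m :: (nat, 'k::field) mpoly set)"
proof
  fix f assume "f \<in> ideal_gen {1..n+1} G"
  then obtain F c where F: "F \<subseteq> G" "\<forall>g\<in>F. c g \<in> polys_in {1..n+1}" and f: "f = (\<Sum>g\<in>F. c g * g)"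
    unfolding ideal_gen_def by blast
  have zero: "(0 :: (nat, 'k) mpoly) \<in> curve_ideal 1 n m"
    by (simp add: curve_ideal_def polys_in_zero poly_subst_def)
  have add: "a + b \<in> curve_ideal 1 n m" if "a \<in> curve_ideal 1 n m" "b \<in> curve_ideal 1 n m"
    for a b :: "(nat, 'k) mpoly"
    using curve_ideal_diff[OF m_le mn_pos that(1) curve_ideal_diff[OF m_le mn_pos zero that(2)]] by simp
  have "c g * g \<in> curve_ideal 1 n m" if "g \<in> F" for g
    using that F assms by (intro curve_ideal_mult[OF m_le mn_pos]) auto
  then show "f \<in> curve_ideal 1 n m"
    unfolding f by (induction F rule: infinite_finite_induct) (simp_all add: zero add del: One_nat_def)
qed

section \<open>Combination with a minimal Groebner basis of I(C')\<close>

context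
  fixes G1 :: "(nat, 'k::field) mpoly set"
  assumes G1: "minimal_groebner_basis {2..n+1} (curve_ideal 2 n m) G1"
begin

lemma G1_finite: "finite G1"
  and G1_ideal: "G1 \<subseteq> curve_ideal 2 n m"
  and G1_dvd: "f \<in> curve_ideal 2 n m \<Longrightarrow> f \<noteq> 0 \<Longrightarrow> \<exists>g\<in>G1. monom_dvd (lead_monom g) (lead_monom f)"
  and G1_monic: "g \<in> G1 \<Longrightarrow> leading_coefficient g = 1"
  and G1_antichain: "f \<in> G1 \<Longrightarrow> g \<in> G1 \<Longrightarrow> monom_dvd (lead_monom f) (lead_monom g) \<Longrightarrow> f = g"
proof -
  have "curve_ideal 2 n m \<subseteq> (polys_in {2..n+1} :: (nat, 'k) mpoly set)"
    by (auto simp: curve_ideal_def)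
  note iff = groebner_basis_iff[OF this, of G1]
  show "finite G1" "G1 \<subseteq> curve_ideal 2 n m"
    using G1 unfolding minimal_groebner_basis_def iff by blast+
  show "\<exists>g\<in>G1. monom_dvd (lead_monom g) (lead_monom f)" if "f \<in> curve_ideal 2 n m" "f \<noteq> 0"
    using G1 that unfolding minimal_groebner_basis_def iff by blast
  show "leading_coefficient g = 1" if "g \<in> G1"
    using G1 that unfolding minimal_groebner_basis_def by blast
  show "f = g" if "f \<in> G1" "g \<in> G1" "monom_dvd (lead_monom f) (lead_monom g)"
    using G1 that unfolding minimal_groebner_basis_def by blast
qed

lemma monic_nonzero: "leading_coefficient g = 1 \<Longrightarrow> g \<noteq> (0 :: (nat, 'k) mpoly)"
  using leading_coefficient_zero[where ?'a = 'k] by (metis zero_neq_one)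

lemma G1_lead:
  assumes "g \<in> G1"
  shows "keys (lead_monom g) \<subseteq> {2..n+1}" "reducible2 (lead_monom g)"
proof -
  have g: "g \<in> curve_ideal 2 n m" "g \<noteq> 0"
    using assms G1_ideal G1_monic monic_nonzero by blast+
  show "keys (lead_monom g) \<subseteq> {2..n+1}"
    using g by (intro keys_lead_monom) (auto simp: curve_ideal_def)
  show "reducible2 (lead_monom g)"
    using curve_ideal_reducible[OF m_le2 mn_pos g] unfolding reducible2_def by metis
qed

lemma reducible2_G1_dvd:
  assumes "keys t \<subseteq> {2..n+1}" "reducible2 t"
  obtains g where "g \<in> G1" "monom_dvd (lead_monom g) t"
proof -
  obtain u where u: "keys u \<subseteq> {2..n+1}" "drl_less u t" "fib t u"
    using assms(2) unfolding reducible2_def by blast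
  let ?f = "monomial t - monomial u :: (nat, 'k) mpoly"
  have "?f \<in> curve_ideal 2 n m"
    using u assms(1) by (intro curve_ideal_binomial[OF m_le2 mn_pos same_fiber_sym])
  moreover have "lead_monom ?f = t" "?f \<noteq> 0"
    using lead_monom_binomial[OF u(2), where ?'k = 'k] monic_nonzero by blast+
  ultimately show ?thesis
    using G1_dvd[of ?f] that by auto
qed

text \<open>The antichain condition makes each leading monomial minimal among the reducible ones: a
  proper reducible divisor would itself be a multiple of a leading monomial of
  \<open>G1\<close>.\<close>

lemma G1_component:
  assumes "g \<in> G1"
  shows "\<exists>S. component (lead_monom g) S"
proof (rule old_lead_component[OF G1_lead[OF assms]])
  fix v assume v: "monom_dvd v (lead_monom g)" "v \<noteq> lead_monom g"
  show "\<not> reducible2 v"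
  proof
    assume red: "reducible2 v"
    have "keys v \<subseteq> {2..n+1}"
      using v(1) G1_lead(1)[OF assms] unfolding monom_dvd_def by (auto simp: keys_add_nat)
    then obtain g' where g': "g' \<in> G1" "monom_dvd (lead_monom g') v"
      using red reducible2_G1_dvd by blast
    then have "g' = g"
      using G1_antichain[OF _ assms] monom_dvd_trans v(1) by blast
    with g' v monom_dvd_antisym show False by blast
  qed
qed

lemma basis_ideal: "g \<in> G1 \<union> new_basis \<Longrightarrow> g \<in> curve_ideal 1 n m"
  using new_basis_elem(3) G1_ideal curve_ideal_subset[of 1 2 n m] by auto

lemma basis_monic: "g \<in> G1 \<union> new_basis \<Longrightarrow> leading_coefficient g = 1"
  using new_basis_elem(2) G1_monic by blast

text \<open>New leading monomials contain x_1, so they divide none from \<open>G1\<close>. If the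
  leading monomial of \<open>f\<close> properly divided a new one, multiplying a reduction of it by
  the cofactor would give another fiber member sharing a variable with the new one, against its
  isolation.\<close>

lemma basis_antichain:
  assumes fg: "f \<in> G1 \<union> new_basis" "g \<in> G1 \<union> new_basis"
    and dvd: "monom_dvd (lead_monom f) (lead_monom g)"
  shows "f = g"
proof (cases "g \<in> G1")
  case True
  then have "lookup (lead_monom g) 1 = 0"
    using G1_lead(1) keys_2_lookup by blast
  then have "lookup (lead_monom f) 1 = 0"
    using dvd unfolding monom_dvd_iff by (metis le_zero_eq)
  then have "f \<notin> new_basis"
    using new_basis_elem(1) new_leads_x1 by fastforce
  with fg True dvd G1_antichain show ?thesis by blast
next
  case False
  with fg have g: "g \<in> new_basis" by blast
  have w: "lead_monom g \<in> new_leads"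
    using g by (rule new_basis_elem(1))
  obtain v where v: "lead_monom g = lead_monom f + v"
    using dvd unfolding monom_dvd_def by blast
  have f: "f \<in> curve_ideal 1 n m" "f \<noteq> 0"
    using fg(1) basis_ideal basis_monic monic_nonzero by blast+
  obtain u where u: "keys u \<subseteq> {1..n+1}" "drl_less u (lead_monom f)" "fib (lead_monom f) u"
    using curve_ideal_reducible[OF m_le mn_pos f] .
  have "v = 0"
  proof (rule ccontr)
    assume "v \<noteq> 0"
    then obtain x where x: "lookup v x > 0"
      by (metis gr_zeroI lookup_zero poly_mapping_eqI)
    have "keys (lead_monom g) \<subseteq> {1..n+1}"
      using w by (rule new_leads_reducible)
    then have "keys (v + u) \<subseteq> {1..n+1}"
      using u(1) by (simp add: v keys_add_nat)
    moreover have "fib (lead_monom g) (v + u)"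
      using u(3) unfolding v add.commute[of "lead_monom f"] by (simp add: same_fiber_add_iff)
    ultimately have "v + u = lead_monom g"
      using new_lead_isolated[OF w, of "v + u" x] x by (simp add: v lookup_add)
    then have "u = lead_monom f"
      unfolding v add.commute[of "lead_monom f"] by simp
    with u(2) drl_irrefl show False by blast
  qed
  then have eq: "lead_monom f = lead_monom g"
    using v by simp
  have "f \<notin> G1"
  proof
    assume "f \<in> G1"
    then have "lookup (lead_monom f) 1 = 0"
      using G1_lead(1) keys_2_lookup by blast
    with eq new_leads_x1[OF w] show False by simp
  qed
  with fg(1) g eq new_basis_inj show ?thesis
    by (auto dest: inj_onD)
qed

lemma basis_groebner: "groebner_basis {1..n+1} (curve_ideal 1 n m) (G1 \<union> new_basis)"
proof -
  have sub: "curve_ideal 1 n m \<subseteq> (polys_in {1..n+1} :: (nat, 'k) mpoly set)"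
    by (auto simp: curve_ideal_def)
  have "finite (G1 \<union> new_basis)"
    using G1_finite by (simp add: new_basis_def)
  moreover have "\<exists>g\<in>(G1 \<union> new_basis) - {0}. monom_dvd (lead_monom g) (lead_monom f)"
    if "f \<in> curve_ideal 1 n m - {0}" for f :: "(nat, 'k) mpoly"
  proof -
    have f: "f \<in> curve_ideal 1 n m" "f \<noteq> 0"
      using that by auto
    obtain u where u: "keys u \<subseteq> {1..n+1}" "drl_less u (lead_monom f)" "fib (lead_monom f) u"
      using curve_ideal_reducible[OF m_le mn_pos f] .
    have kf: "keys (lead_monom f) \<subseteq> {1..n+1}"
      by (rule keys_lead_monom[OF subsetD[OF sub f(1)] f(2)])
    have "\<exists>g\<in>G1 \<union> new_basis. monom_dvd (lead_monom g) (lead_monom f)"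
      using kf u
    proof (rule reducible_divisor)
      fix w assume w: "w \<in> new_leads" "monom_dvd w (lead_monom f)"
      obtain g :: "(nat, 'k) mpoly" where "g \<in> new_basis" "lead_monom g = w"
        using w(1) by (rule new_basis_surj)
      with w(2) show ?thesis by blast
    next
      fix v assume v: "keys v \<subseteq> {2..n+1}" "reducible2 v" "monom_dvd v (lead_monom f)"
      obtain g where "g \<in> G1" "monom_dvd (lead_monom g) v"
        using v(1,2) by (rule reducible2_G1_dvd)
      with v(3) monom_dvd_trans show ?thesis by blast
    qed
    then show ?thesis
      using basis_monic monic_nonzero by blast
  qed
  ultimately show ?thesis
    unfolding groebner_basis_iff[OF sub] using basis_ideal by blast
qed

lemma basis_minimal_groebner:
  "minimal_groebner_basis {1..n+1} (curve_ideal 1 n m) (G1 \<union> new_basis)"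
  unfolding minimal_groebner_basis_def using basis_groebner basis_monic basis_antichain by blast

lemma basis_minimal_generating:
  "minimal_generating_set {1..n+1} (curve_ideal 1 n m) (G1 \<union> new_basis)"
proof -
  let ?I = "curve_ideal 1 n m :: (nat, 'k) mpoly set" and ?G = "G1 \<union> new_basis"
  have sub: "?I \<subseteq> polys_in {1..n+1}"
    by (auto simp: curve_ideal_def)
  have GI: "?G \<subseteq> ?I"
    using basis_ideal by blast
  have "?I \<subseteq> ideal_gen {1..n+1} ?G"
  proof (rule groebner_basis_generates[OF _ sub _ _ basis_groebner basis_monic])
    show "finite {1..n+1}" by simp
  qed (use curve_ideal_diff[OF m_le mn_pos] curve_ideal_mult[OF m_le mn_pos] in blast)+
  then have "ideal_gen {1..n+1} ?G = ?I"
    using curve_ideal_closed_gen[OF GI] by blast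
  moreover have "ideal_gen {1..n+1} H \<noteq> ?I" if "H \<subset> ?G" for H
  proof (rule no_proper_generating_subset[OF GI basis_monic _ _ that])
    show "inj_on lead_monom ?G"
      by (rule inj_onI) (metis basis_antichain monom_dvd_refl)
    fix g assume g: "g \<in> ?G"
    obtain S where S: "component (lead_monom g) S"
      using g G1_component new_lead_component new_basis_elem(1) by blast
    \<comment> \<open>The coefficient sum over \<open>S\<close>; triangularity comes from the
      leading monomial being least in \<open>S\<close>.\<close>
    let ?\<phi> = "\<lambda>t. if t \<in> S then 1 else 0 :: 'k"
    have "?\<phi> (lead_monom g) = 1"
      using S by (simp add: component_def)
    moreover have "\<forall>t. drl_less t (lead_monom g) \<longrightarrow> ?\<phi> t = 0"
      using S drl_asym drl_irrefl unfolding component_def by metis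
    moreover have "\<forall>u b. u \<noteq> 0 \<longrightarrow> keys u \<subseteq> {1..n+1} \<longrightarrow> b \<in> ?I \<longrightarrow> linear_ext (\<lambda>t. ?\<phi> (u + t)) b = 0"
      using component_functional[OF S] by blast
    ultimately show "\<exists>\<phi> :: nat monom \<Rightarrow> 'k. \<phi> (lead_monom g) = 1 \<and>
        (\<forall>t. drl_less t (lead_monom g) \<longrightarrow> \<phi> t = 0) \<and>
        (\<forall>u b. u \<noteq> 0 \<longrightarrow> keys u \<subseteq> {1..n+1} \<longrightarrow> b \<in> ?I \<longrightarrow> linear_ext (\<lambda>t. \<phi> (u + t)) b = 0)"
      by (intro exI[of _ ?\<phi>] conjI)
  qed
  ultimately show ?thesis
    unfolding minimal_generating_set_def by blast
qed

end

end

theorem theorem3p10: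
  fixes n h d p s :: nat and m :: "nat \<Rightarrow> nat"
    and G1 :: "(nat, 'k::field) mpoly set"
  assumes K_infinite: "infinite (UNIV :: 'k set)"
    and n: "n \<ge> 3"
    and m_pos: "\<forall>i\<in>{1..n}. m i > 0"
    and m_mono: "strict_mono_on {1..n} m"
    and m_def: "\<forall>i\<in>{2..n}. m i = h * m 1 + (i - 1) * d"
    and h: "h > 1" and d: "d > 0"
    and coprime: "gcd (m 1) d = 1"
    and h_dvd: "h dvd d"
    and p_s: "s \<in> {1..n-1}" "m 1 = p * (n - 1) + s"
    and G1: "minimal_groebner_basis {2..n+1} (curve_ideal 2 n m) G1"
  defines "G \<equiv> G1
      \<union> {X 1 ^ h * X i - X 2 * X (i - 1) * X (n + 1) ^ (h - 1) | i. 3 \<le> i \<and> i \<le> n}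
      \<union> {X 1 ^ (j * h) * X 2 ^ beta n m h d p j
            - X (sigma n m h d p s j) * X n ^ lambda n m h d p s j
                * X (n + 1) ^ (j * (h - 1) + d div h) | j. 1 \<le> j \<and> j \<le> delta h d p div h}"
  shows "minimal_groebner_basis {1..n+1} (curve_ideal 1 n m) G
    \<and> minimal_generating_set {1..n+1} (curve_ideal 1 n m) G"
proof -
  interpret almost_arithmetic n h d p s m
    by unfold_locales (use assms in auto)
  have "G = G1 \<union> new_basis"
    unfolding G_def new_basis_eq by (simp add: Un_assoc)
  then show ?thesis
    using basis_minimal_groebner[OF G1] basis_minimal_generating[OF G1] by simp
qed

end
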